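(* Let $X$ be a Hilbert space and $V$ a closed convex body (not necessarily bounded) with $S=\partial V$ a $C^1$ submanifold and outer unit normal $N_S:S\to S_X$. Let $\omega$ be a modulus of continuity and $\varphi(t):=\int_0^t\omega(s)\,ds$. The following are equivalent: (1) There is $M>0$ with $\|N_S(x)-N_S(y)\|\le M\omega(\|x-y\|)$ for all $x,y\in S$. (2) There is $M>0$ such that for every $x\in S$ the set $W_x:=\{p\in X: \langle N_S(x),x-p\rangle\ge M\varphi(2\|x-p\|)\}$ satisfies $W_x\subseteq V$ and $S\cap W_x=\{x\}$. (3) There is $M>0$ with $\langle N_S(y),y-x\rangle\ge \tfrac{\|N_S(x)-N_S(y)\|}{2}\,\omega^{-1}\!\left(\tfrac{\|N_S(x)-N_S(y)\|}{4M}\right)$ for all $x,y\in S$. (4) There exists a convex function $F:X\to\mathbb{R}$ of class $C^{1,\omega}$ such that $S=F^{-1}(1)$ and $\nabla F(x)=N_S(x)$ for all $x\in S$. (5) $S$ is a convex hypersurface of class $C^{1,\omega}$. Furthermore, if $V$ is bounded and $0\in\operatorname{int}(V)$, these are also equivalent to: (6) for every $\alpha>0$, the Minkowski functional $\mu_V$ is of class $C^{1,\omega}$ on $\{x\in X:\mu_V(x)\ge\alpha\}$, i.e. it is differentiable there and there is $K_\alpha>0$ with $\|\nabla\mu_V(x)-\nabla\mu_V(y)\|\le K_\alpha\,\omega(\|x-y\|)$ for all $x,y$ in that set.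
   Context: A convex body is a closed convex set with nonempty interior (possibly unbounded). A modulus of continuity is a concave, strictly increasing function $\omega:[0,\infty)\to[0,\infty)$ with $\omega(0)=0$ and $\lim_{t\to\infty}\omega(t)=\infty$; $\omega^{-1}$ denotes its inverse. A function $F:X\to\mathbb{R}$ on a Banach space is of class $C^{1,\omega}$ if it is Fréchet differentiable and there is $K>0$ with $\|DF(x)-DF(y)\|_*\le K\omega(\|x-y\|)$ for all $x,y$. A subset $S$ of a Banach space $X$ is a convex hypersurface of class $C^{1,\omega}$ if there exist $M>0$ and a convex function $F\in C^{1,\omega}(X)$ with $S=F^{-1}(1)$ and $M^{-1}\le\|DF(x)\|_*\le M$ for all $x\in S$. For $0\in\operatorname{int}(V)$, $\mu_V(x)=\inf\{t>0:x/t\in V\}$.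
   Formalization: The modulus of continuity ω is additionally assumed continuous on [0,∞); without continuity at 0 (e.g. ω(0)=0, ω(t)=1+t for t>0) the inverse ω^{-1} used in (3) is undefined at small positive arguments. *)

theory Defs
  imports "HOL-Analysis.Analysis"
begin

text \<open>Modulus of continuity: concave, strictly increasing, continuous on [0,oo),
  omega 0 = 0, tends to infinity.  (Continuity is implicit in the paper's use of
  the inverse function omega^-1 on [0,oo).)\<close>
definition modulus_of_continuity :: "(real \<Rightarrow> real) \<Rightarrow> bool" where
  "modulus_of_continuity \<omega> \<longleftrightarrow>
     concave_on {0..} \<omega> \<and> strict_mono_on {0..} \<omega> \<and> continuous_on {0..} \<omega> \<and>
     \<omega> 0 = 0 \<and> (\<forall>t\<ge>0. \<omega> t \<ge> 0) \<and> filterlim \<omega> at_top at_top"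

definition modinv :: "(real \<Rightarrow> real) \<Rightarrow> real \<Rightarrow> real" where
  "modinv \<omega> = inv_into {0..} \<omega>"

definition convex_body :: "'a::real_normed_vector set \<Rightarrow> bool" where
  "convex_body V \<longleftrightarrow> closed V \<and> convex V \<and> interior V \<noteq> {}"

definition C1w_with :: "(real \<Rightarrow> real) \<Rightarrow> ('a::real_normed_vector \<Rightarrow> real) \<Rightarrow> ('a \<Rightarrow> 'a \<Rightarrow>\<^sub>L real) \<Rightarrow> bool" where
  "C1w_with \<omega> F F' \<longleftrightarrow> (\<forall>x. (F has_derivative blinfun_apply (F' x)) (at x)) \<and>
     (\<exists>K>0. \<forall>x y. norm (F' x - F' y) \<le> K * \<omega> (norm (x - y)))"

definition convex_hypersurface_C1w :: "(real \<Rightarrow> real) \<Rightarrow> 'a::real_normed_vector set \<Rightarrow> bool" where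
  "convex_hypersurface_C1w \<omega> S \<longleftrightarrow>
     (\<exists>M>0. \<exists>F F'. convex_on UNIV F \<and> C1w_with \<omega> F F' \<and> S = F -` {1} \<and>
        (\<forall>x\<in>S. 1 / M \<le> norm (F' x) \<and> norm (F' x) \<le> M))"

definition C1_hypersurface :: "'a::real_normed_vector set \<Rightarrow> bool" where
  "C1_hypersurface S \<longleftrightarrow>
     (\<forall>x\<in>S. \<exists>U (g :: 'a \<Rightarrow> real) g'. open U \<and> x \<in> U \<and>
        (\<forall>y\<in>U. (g has_derivative blinfun_apply (g' y)) (at y)) \<and>
        continuous_on U g' \<and> g' x \<noteq> 0 \<and> S \<inter> U = {y\<in>U. g y = 0})"

definition outer_unit_normal :: "'a::real_inner set \<Rightarrow> ('a \<Rightarrow> 'a) \<Rightarrow> bool" where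
  "outer_unit_normal V N \<longleftrightarrow>
     (\<forall>x\<in>frontier V. norm (N x) = 1 \<and> (\<forall>y\<in>V. inner (N x) (y - x) \<le> 0))"

definition minkowski_functional :: "'a::real_normed_vector set \<Rightarrow> 'a \<Rightarrow> real" where
  "minkowski_functional V x = Inf {t. t > 0 \<and> x /\<^sub>R t \<in> V}"

end

theory Submission
  imports Defs
begin

text \<open>
  (1) \<open>\<Longrightarrow>\<close> (2): for \<open>p\<close> outside the interior, a segment from an interior point near \<open>x\<close> to \<open>p\<close>
  meets \<open>S\<close> at some \<open>y\<close> with \<open>\<langle>N y, p - x\<rangle> \<ge> 0\<close> and \<open>\<parallel>x - y\<parallel> \<le> \<parallel>x - p\<parallel>\<close>.
  (2) \<open>\<Longrightarrow>\<close> (3): test the supporting half-space at \<open>y\<close> with the point of \<open>W\<^sub>x\<close> in direction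
  \<open>N y - N x\<close>. (3) \<open>\<Longrightarrow>\<close> (1): add the inequality for \<open>(x, y)\<close> and \<open>(y, x)\<close>.

  (3) \<open>\<Longrightarrow>\<close> (4): \<open>F - 1\<close> is the largest convex function below the tangent bowls
  \<open>\<langle>N y, x - y\<rangle> + C \<phi>(\<parallel>x - y\<parallel>)\<close>, \<open>y \<in> S\<close>, and below bowls of negative depth centred at points deep
  inside \<open>V\<close>. By (3) all of these lie above the supporting functionals \<open>\<langle>N y, x - y\<rangle>\<close>, which
  fixes \<open>F\<close> and its gradient on \<open>S\<close>. The envelope inherits the upper bound on second differences
  of the bowls, and for a convex function such a bound yields class \<open>C\<^sup>1\<^sup>,\<^sup>\<omega>\<close>.
  The deep bowls are needed to make \<open>F < 1\<close> inside an unbounded \<open>V\<close> such as a half-space.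

  (5) \<open>\<Longrightarrow>\<close> (1): the derivative of \<open>F\<close> is a normal functional of \<open>V\<close> up to a global sign, and the
  normal direction is unique because \<open>S\<close> is \<open>C\<^sup>1\<close>. For (6), \<open>N s / \<langle>N s, s\<rangle>\<close> with \<open>s = x / \<mu> x\<close> is a
  subgradient of \<open>\<mu>\<close> at \<open>x\<close>.
\<close>

section \<open>Moduli of continuity\<close>

locale modulus =
  fixes \<omega> :: "real \<Rightarrow> real"
  assumes modulus: "modulus_of_continuity \<omega>"
begin

definition \<phi> :: "real \<Rightarrow> real" where "\<phi> t = integral {0..t} \<omega>"

lemma modulus_zero [simp]: "\<omega> 0 = 0"
  and modulus_nonneg: "0 \<le> t \<Longrightarrow> 0 \<le> \<omega> t"
  and modulus_concave: "concave_on {0..} \<omega>"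
  and modulus_continuous: "continuous_on {0..} \<omega>"
  and modulus_at_top: "filterlim \<omega> at_top at_top"
  using modulus by (auto simp: modulus_of_continuity_def)

lemma modulus_less: "0 \<le> s \<Longrightarrow> s < t \<Longrightarrow> \<omega> s < \<omega> t"
  using modulus by (auto simp: modulus_of_continuity_def strict_mono_on_def)

lemma modulus_mono: "0 \<le> s \<Longrightarrow> s \<le> t \<Longrightarrow> \<omega> s \<le> \<omega> t"
  using modulus_less[of s t] by (cases "s = t") auto

lemma modulus_pos: "0 < t \<Longrightarrow> 0 < \<omega> t"
  using modulus_less[of 0 t] by simp

lemma modulus_le_iff: "0 \<le> s \<Longrightarrow> 0 \<le> t \<Longrightarrow> \<omega> s \<le> \<omega> t \<longleftrightarrow> s \<le> t"
  using modulus_less[of t s] modulus_mono[of s t] by linarith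

text \<open>Concavity together with \<open>\<omega> 0 = 0\<close> makes
  \<open>\<omega> t / t\<close> nonincreasing; the product form also covers \<open>t = 0\<close>.
  Subadditivity, scaling and the comparison of a distance with its modulus all rest on this.\<close>

lemma modulus_star: "s * \<omega> t \<le> t * \<omega> s" if "0 \<le> s" "s \<le> t"
proof (cases "t = 0")
  case False
  then have t: "0 < t" using that by simp
  have "\<omega> ((1 - s/t) *\<^sub>R 0 + (s/t) *\<^sub>R t) \<ge> (1 - s/t) * \<omega> 0 + (s/t) * \<omega> t"
    using that t modulus_concave by (intro concave_onD) (auto simp: field_simps)
  then show ?thesis using t by (simp add: field_simps)
qed (use that in auto)

text \<open>Compare \<open>s\<close> and \<open>t\<close> separately with \<open>s + t\<close> by
  \<open>modulus_star\<close> and add the two inequalities.\<close>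

lemma modulus_subadd: "\<omega> (s + t) \<le> \<omega> s + \<omega> t" if "0 \<le> s" "0 \<le> t"
proof (cases "s + t = 0")
  case False
  then have st: "0 < s + t" using that by simp
  have "s * \<omega> (s+t) \<le> (s+t) * \<omega> s" "t * \<omega> (s+t) \<le> (s+t) * \<omega> t"
    using modulus_star[of s "s+t"] modulus_star[of t "s+t"] that by auto
  then have "(s+t) * \<omega> (s+t) \<le> (s+t) * (\<omega> s + \<omega> t)" by (simp add: algebra_simps)
  then show ?thesis using st by simp
qed (use that modulus_nonneg in auto)

lemma modulus_scale: "\<omega> (L * t) \<le> L * \<omega> t" if "0 \<le> t" "1 \<le> L"
proof (cases "t = 0")
  case False
  have "t * \<omega> (L * t) \<le> (L * t) * \<omega> t"
    using that by (intro modulus_star) (auto simp: mult_le_cancel_right1)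
  then have "t * \<omega> (L * t) \<le> t * (L * \<omega> t)" by (simp add: algebra_simps)
  then show ?thesis using that False by simp
qed simp

lemma modulus_surj: "\<exists>t\<ge>0. \<omega> t = s" if "0 \<le> s"
proof -
  obtain b where "\<And>t. b \<le> t \<Longrightarrow> s \<le> \<omega> t"
    using modulus_at_top by (auto simp: filterlim_at_top eventually_at_top_linorder)
  then have "s \<le> \<omega> (max b 0)" by auto
  moreover have "continuous_on {0..max b 0} \<omega>"
    using modulus_continuous by (rule continuous_on_subset) auto
  ultimately show ?thesis
    using IVT'[of \<omega> 0 s "max b 0"] that by auto
qed

lemma modinv_nonneg: "0 \<le> s \<Longrightarrow> 0 \<le> modinv \<omega> s"
  and modulus_modinv: "0 \<le> s \<Longrightarrow> \<omega> (modinv \<omega> s) = s"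
  using modulus_surj[of s] inv_into_into[of s \<omega> "{0..}"] f_inv_into_f[of s \<omega> "{0..}"]
  by (auto simp: modinv_def)

lemma modinv_pos: "0 < s \<Longrightarrow> 0 < modinv \<omega> s"
  using modinv_nonneg[of s] modulus_modinv[of s] by (cases "modinv \<omega> s = 0") auto

lemma modinv_le_iff: "0 \<le> s \<Longrightarrow> 0 \<le> t \<Longrightarrow> modinv \<omega> s \<le> t \<longleftrightarrow> s \<le> \<omega> t"
  using modulus_le_iff[of "modinv \<omega> s" t] modinv_nonneg[of s] modulus_modinv[of s] by auto

lemma modulus_integrable: "0 \<le> a \<Longrightarrow> \<omega> integrable_on {a..b}"
  by (rule integrable_continuous_interval, rule continuous_on_subset[OF modulus_continuous]) auto

section \<open>The primitive \<open>\<phi>\<close> of \<open>\<omega>\<close> and the radial bowls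
  \<open>\<phi> (norm x)\<close>\<close>

lemma phi_zero [simp]: "\<phi> 0 = 0"
  by (simp add: \<phi>_def)

lemma phi_diff_bounds:
  assumes "0 \<le> a" "a \<le> b"
  shows "(b - a) * \<omega> a \<le> \<phi> b - \<phi> a" "\<phi> b - \<phi> a \<le> (b - a) * \<omega> b"
proof -
  have "integral {0..a} \<omega> + integral {a..b} \<omega> = integral {0..b} \<omega>"
    using assms by (intro Henstock_Kurzweil_Integration.integral_combine modulus_integrable) auto
  then have eq: "\<phi> b - \<phi> a = integral {a..b} \<omega>" by (simp add: \<phi>_def)
  have "integral {a..b} (\<lambda>_. \<omega> a) \<le> integral {a..b} \<omega>"
    using assms by (intro integral_le modulus_integrable modulus_mono) auto
  then show "(b - a) * \<omega> a \<le> \<phi> b - \<phi> a" using assms eq by simp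
  have "integral {a..b} \<omega> \<le> integral {a..b} (\<lambda>_. \<omega> b)"
    using assms by (intro integral_le modulus_integrable modulus_mono) auto
  then show "\<phi> b - \<phi> a \<le> (b - a) * \<omega> b" using assms eq by simp
qed

text \<open>Convexity of \<open>\<phi>\<close>: its derivative \<open>\<omega>\<close> is
  nondecreasing. The two orders of \<open>a\<close> and \<open>b\<close> use the two bounds on the
  integral between them.\<close>

lemma phi_subgradient: "\<omega> a * (b - a) \<le> \<phi> b - \<phi> a" if "0 \<le> a" "0 \<le> b"
proof (cases "a \<le> b")
  case True
  then show ?thesis using phi_diff_bounds(1)[of a b] that by (simp add: mult.commute)
next
  case False
  then show ?thesis using phi_diff_bounds(2)[of b a] that by (simp add: algebra_simps)
qed

lemma phi_mono: "0 \<le> a \<Longrightarrow> a \<le> b \<Longrightarrow> \<phi> a \<le> \<phi> b"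
  using phi_subgradient[of a b] modulus_nonneg[of a] mult_nonneg_nonneg[of "\<omega> a" "b - a"] by linarith

lemma phi_le: "0 \<le> t \<Longrightarrow> \<phi> t \<le> t * \<omega> t"
  using phi_diff_bounds(2)[of 0 t] by simp

lemma phi_nonneg: "0 \<le> t \<Longrightarrow> 0 \<le> \<phi> t"
  using phi_mono[of 0 t] by simp

lemma phi_double_ge: "t * \<omega> t \<le> \<phi> (2 * t)" if "0 \<le> t"
  using phi_diff_bounds(1)[of t "2 * t"] phi_nonneg[of t] that by simp

lemma phi_double_pos: "0 < t \<Longrightarrow> 0 < \<phi> (2 * t)"
  using phi_double_ge[of t] modulus_pos[of t] mult_pos_pos[of t "\<omega> t"] by linarith

lemma phi_double_le: "\<phi> (2 * t) \<le> 4 * (t * \<omega> t)" if "0 \<le> t"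
proof -
  have "\<phi> (2 * t) \<le> 2 * t * \<omega> (2 * t)" using phi_le[of "2*t"] that by simp
  also have "\<dots> \<le> 2 * t * (2 * \<omega> t)"
    using modulus_scale[of t 2] that by (intro mult_left_mono) auto
  finally show ?thesis by simp
qed

text \<open>Together with \<open>phi_le\<close> this makes \<open>\<phi> t\<close> and
  \<open>t * \<omega> t\<close> interchangeable up to a factor 4. Only the upper half of the
  integration interval is used.\<close>

lemma phi_ge: "t * \<omega> t \<le> 4 * \<phi> t" if "0 \<le> t"
proof -
  have "t * \<omega> t \<le> t * (2 * \<omega> (t/2))"
    using modulus_scale[of "t/2" 2] that by (intro mult_left_mono) auto
  then show ?thesis using phi_double_ge[of "t/2"] that by simp
qed

text \<open>The vector field here is the gradient of the bowl \<open>\<phi> (norm x)\<close>. The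
  change of length contributes \<open>\<omega> d\<close> by subadditivity, the change of direction
  \<open>2 * \<omega> d\<close>, where \<open>d = norm (x - y)\<close>.\<close>

lemma radial_diff_bound:
  fixes x y :: "'b::real_inner"
  shows "norm (\<omega> (norm x) *\<^sub>R sgn x - \<omega> (norm y) *\<^sub>R sgn y) \<le> 3 * \<omega> (norm (x - y))"
proof (induction "norm y" "norm x" arbitrary: x y rule: linorder_wlog)
  case (sym x y)
  then show ?case by (simp add: norm_minus_commute)
next
  case (le x y)
  define d where "d = norm (x - y)"
  have d: "0 \<le> d" by (simp add: d_def)
  have xyd: "norm x \<le> norm y + d" 
    unfolding d_def using norm_triangle_sub[of x y] by simp
  have "\<omega> (norm x) \<le> \<omega> (norm y + d)" by (intro modulus_mono xyd) auto
  also have "\<dots> \<le> \<omega> (norm y) + \<omega> d" by (rule modulus_subadd) (auto simp: d)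
  finally have 1: "\<bar>\<omega> (norm x) - \<omega> (norm y)\<bar> \<le> \<omega> d"
    using modulus_mono[OF _ le] modulus_nonneg[OF d] by auto
  have n1: "norm (sgn v) \<le> 1" for v :: 'b by (simp add: norm_sgn)
  have 2: "\<omega> (norm y) * norm (sgn x - sgn y) \<le> 2 * \<omega> d"
  \<comment> \<open>Near the origin, directions are uncontrolled but
    \<open>\<omega> (norm y) \<le> \<omega> d\<close>. Away from it, directions differ by at most
    \<open>2 * d / norm y\<close>, and \<open>modulus_star\<close> trades
    \<open>d * \<omega> (norm y)\<close> for \<open>norm y * \<omega> d\<close>.\<close>
  proof (cases "norm y \<le> d")
    case True
    have "norm (sgn x - sgn y) \<le> 2" using norm_triangle_ineq4[of "sgn x" "sgn y"] n1[of x] n1[of y] by simp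
    then have "\<omega> (norm y) * norm (sgn x - sgn y) \<le> \<omega> d * 2"
      using True by (intro mult_mono modulus_mono modulus_nonneg d) auto
    then show ?thesis by simp
  next
    case False
    then have y: "norm y > 0" using d by linarith
    have x0: "norm x > 0" using y le by linarith
    have "norm y *\<^sub>R (sgn x - sgn y) = (x - y) + ((norm y - norm x) / norm x) *\<^sub>R x"
      using y x0 by (simp add: sgn_div_norm scaleR_right_diff_distrib diff_divide_distrib
          scaleR_left_diff_distrib divide_inverse left_diff_distrib)
    then have "norm (norm y *\<^sub>R (sgn x - sgn y)) \<le> d + norm (((norm y - norm x) / norm x) *\<^sub>R x)"
      unfolding d_def by (metis norm_triangle_ineq)
    also have "\<dots> \<le> 2 * d" using x0 le xyd by simp
    finally have *: "norm y * norm (sgn x - sgn y) \<le> 2 * d" by simp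
    have "norm y * (\<omega> (norm y) * norm (sgn x - sgn y)) \<le> \<omega> (norm y) * (2 * d)"
      using mult_left_mono[OF *, of "\<omega> (norm y)"] modulus_nonneg[of "norm y"] by (simp add: ac_simps)
    also have "\<dots> \<le> norm y * (2 * \<omega> d)" using modulus_star[of d "norm y"] False d by (simp add: mult.commute)
    finally show ?thesis using y by simp
  qed
  have "\<omega> (norm x) *\<^sub>R sgn x - \<omega> (norm y) *\<^sub>R sgn y
      = (\<omega> (norm x) - \<omega> (norm y)) *\<^sub>R sgn x + \<omega> (norm y) *\<^sub>R (sgn x - sgn y)"
    by (simp add: algebra_simps)
  also have "norm \<dots> \<le> \<bar>\<omega> (norm x) - \<omega> (norm y)\<bar> * norm (sgn x) + \<omega> (norm y) * norm (sgn x - sgn y)"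
    using norm_triangle_ineq[of "(\<omega> (norm x) - \<omega> (norm y)) *\<^sub>R sgn x" "\<omega> (norm y) *\<^sub>R (sgn x - sgn y)"]
      modulus_nonneg[of "norm y"] by simp
  also have "\<dots> \<le> \<omega> d * 1 + 2 * \<omega> d"
    using 1 n1[of x] modulus_nonneg[OF d] by (intro add_mono[OF mult_mono 2]) auto
  finally show ?case by (simp add: d_def)
qed

text \<open>A chain rule for subgradients: \<open>sgn v\<close> is one for the norm at
  \<open>v\<close>, \<open>\<omega> (norm v)\<close> is one for \<open>\<phi>\<close>, and the
  latter is nonnegative.\<close>

lemma bowl_subgradient:
  fixes v w :: "'b::real_inner"
  shows "inner (\<omega> (norm v) *\<^sub>R sgn v) (w - v) \<le> \<phi> (norm w) - \<phi> (norm v)"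
proof -
  have "inner (sgn v) (w - v) \<le> norm w - norm v"
  proof -
    have "inner (sgn v) w \<le> norm (sgn v) * norm w" by (rule norm_cauchy_schwarz)
    also have "\<dots> \<le> norm w" by (simp add: norm_sgn)
    moreover have "inner (sgn v) v = norm v"
      by (cases "v = 0") (simp_all add: sgn_div_norm power2_norm_eq_inner[symmetric] power2_eq_square)
    ultimately show ?thesis by (simp add: inner_diff_right)
  qed
  then have "\<omega> (norm v) * inner (sgn v) (w - v) \<le> \<omega> (norm v) * (norm w - norm v)"
    by (intro mult_left_mono modulus_nonneg) auto
  also have "\<dots> \<le> \<phi> (norm w) - \<phi> (norm v)" by (rule phi_subgradient) auto
  finally show ?thesis by simp
qed

text \<open>Adding the subgradient inequalities based at \<open>x + u\<close> and
  \<open>x - u\<close>, both tested at \<open>x\<close>, leaves the gradient difference against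
  \<open>u\<close>. Its base points are \<open>2 *\<^sub>R u\<close> apart, so the constant is 3
  times 2.\<close>

lemma bowl_second_difference:
  fixes x u :: "'b::real_inner"
  shows "\<phi> (norm (x + u)) + \<phi> (norm (x - u)) - 2 * \<phi> (norm x) \<le> 6 * (norm u * \<omega> (norm u))"
proof -
  define g where "g v = \<omega> (norm v) *\<^sub>R sgn v" for v :: 'b
  have "\<phi> (norm (x + u)) + \<phi> (norm (x - u)) - 2 * \<phi> (norm x) \<le> inner (g (x + u) - g (x - u)) u"
    using bowl_subgradient[of "x+u" x] bowl_subgradient[of "x-u" x]
    by (simp add: g_def[symmetric] inner_diff_left)
  also have "\<dots> \<le> norm (g (x + u) - g (x - u)) * norm u" by (rule norm_cauchy_schwarz)
  also have "\<dots> \<le> (3 * \<omega> (norm (2 *\<^sub>R u))) * norm u"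
    using radial_diff_bound[of "x+u" "x-u"] by (intro mult_right_mono) (auto simp: g_def scaleR_2)
  also have "\<dots> \<le> (3 * (2 * \<omega> (norm u))) * norm u"
    using modulus_scale[of "norm u" 2] by (intro mult_right_mono mult_left_mono) auto
  finally show ?thesis by (simp add: ac_simps)
qed

lemma modulus_small: "0 < e \<Longrightarrow> \<exists>d>0. \<forall>t. 0 \<le> t \<longrightarrow> t \<le> d \<longrightarrow> \<omega> t < e"
  using modulus_modinv[of "e/2"] modinv_pos[of "e/2"] modulus_mono[of _ "modinv \<omega> (e/2)"]
  by (intro exI[of _ "modinv \<omega> (e/2)"]) force

lemma has_derivative_of_modulus_bound:
  fixes f :: "'b::real_normed_vector \<Rightarrow> real"
  assumes D: "bounded_linear D" and "0 < \<epsilon>"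
    and bd: "\<And>u. norm u < \<epsilon> \<Longrightarrow> \<bar>f (x + u) - f x - D u\<bar> \<le> K * (norm u * \<omega> (norm u))"
  shows "(f has_derivative D) (at x)"
  unfolding has_derivative_at_alt
proof (intro conjI D allI impI)
  fix e :: real assume e: "0 < e"
  \<comment> \<open>The maximum keeps the divisor in \<open>e / k\<close> positive for every real
    \<open>K\<close>.\<close>
  define k where "k = max K 1"
  obtain d where d: "d > 0" "\<And>t. 0 \<le> t \<Longrightarrow> t \<le> d \<Longrightarrow> \<omega> t < e / k"
    using modulus_small[of "e / k"] e by (auto simp: k_def)
  have "norm (f y - f x - D (y - x)) \<le> e * norm (y - x)" if y: "norm (y - x) < min d \<epsilon>" for y
  proof -
    have "norm (f y - f x - D (y - x)) \<le> K * (norm (y - x) * \<omega> (norm (y - x)))"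
      using bd[of "y - x"] y by simp
    also have "\<dots> \<le> k * (norm (y - x) * (e / k))"
      using d(2)[of "norm (y - x)"] y modulus_nonneg[of "norm (y - x)"]
      by (intro mult_mono) (auto simp: k_def)
    finally show ?thesis by (simp add: k_def mult.commute)
  qed
  then show "\<exists>d>0. \<forall>y. norm (y - x) < d \<longrightarrow> norm (f y - f x - D (y - x)) \<le> e * norm (y - x)"
    using d(1) \<open>0 < \<epsilon>\<close> by (intro exI[of _ "min d \<epsilon>"]) auto
qed

end

section \<open>Convex functions with controlled second differences\<close>

text \<open>The supremum of all convex minorants of \<open>\<Psi>\<close>: \<open>h0\<close> makes
  the family nonempty, and any member of \<open>\<Psi>\<close> bounds it from above.\<close>

lemma convex_envelope_exists:
  fixes \<Psi> :: "('b::real_vector \<Rightarrow> real) set"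
  assumes ne: "\<Psi> \<noteq> {}" and h0: "convex_on UNIV h0" "\<And>\<psi> x. \<psi> \<in> \<Psi> \<Longrightarrow> h0 x \<le> \<psi> x"
    and sd: "\<And>\<psi> x u. \<psi> \<in> \<Psi> \<Longrightarrow> \<psi> (x + u) + \<psi> (x - u) - 2 * \<psi> x \<le> \<sigma> u"
  shows "\<exists>f. convex_on UNIV f \<and> (\<forall>\<psi>\<in>\<Psi>. \<forall>x. f x \<le> \<psi> x) \<and>
    (\<forall>h. convex_on UNIV h \<and> (\<forall>\<psi>\<in>\<Psi>. \<forall>x. h x \<le> \<psi> x) \<longrightarrow> (\<forall>x. h x \<le> f x)) \<and>
    (\<forall>x u. f (x + u) + f (x - u) - 2 * f x \<le> \<sigma> u)"
proof -
  define H where "H = {h. convex_on UNIV h \<and> (\<forall>\<psi>\<in>\<Psi>. \<forall>x. h x \<le> \<psi> x)}"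
  define f where "f x = (SUP h\<in>H. h x)" for x
  have h0H: "h0 \<in> H" using h0 by (auto simp: H_def)
  have bdd: "bdd_above ((\<lambda>h. h x) ` H)" for x
    using ne by (auto simp: H_def bdd_above_def)
  have upper: "h x \<le> f x" if "h \<in> H" for h x
    unfolding f_def using that bdd by (rule cSUP_upper)
  have least: "f x \<le> b" if "\<And>h. h \<in> H \<Longrightarrow> h x \<le> b" for x b
    unfolding f_def using h0H that by (intro cSUP_least) auto
  have fconv: "convex_on UNIV f"
  proof (rule convex_onI)
    fix t :: real and x y :: 'b assume t: "0 < t" "t < 1"
    show "f ((1 - t) *\<^sub>R x + t *\<^sub>R y) \<le> (1 - t) * f x + t * f y"
    proof (rule least)
      fix h assume h: "h \<in> H"
      then have "h ((1 - t) *\<^sub>R x + t *\<^sub>R y) \<le> (1 - t) * h x + t * h y"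
        using t by (intro convex_onD) (auto simp: H_def)
      also have "\<dots> \<le> (1 - t) * f x + t * f y"
        using t upper[OF h] by (intro add_mono mult_left_mono) auto
      finally show "h ((1 - t) *\<^sub>R x + t *\<^sub>R y) \<le> (1 - t) * f x + t * f y" .
    qed
  qed auto
  have fle: "f x \<le> \<psi> x" if "\<psi> \<in> \<Psi>" for \<psi> x
    using that by (intro least) (auto simp: H_def)
  have "f (x + u) + f (x - u) - 2 * f x \<le> \<sigma> u" for x u
  proof -
    \<comment> \<open>The averaged function \<open>h\<close> is again a convex minorant of \<open>\<Psi>\<close>, hence lies below \<open>f\<close>.\<close>
    define h where "h y = (f (y + u) + f (y - u) - \<sigma> u) / 2" for y
    have "convex_on UNIV h"
    proof (rule convex_onI)
      fix t :: real and a b :: 'b assume t: "0 < t" "t < 1"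
      have "f ((1 - t) *\<^sub>R (a + v) + t *\<^sub>R (b + v)) \<le> (1 - t) * f (a + v) + t * f (b + v)" for v
        using t fconv by (intro convex_onD) auto
      from this[of u] this[of "- u"]
      show "h ((1 - t) *\<^sub>R a + t *\<^sub>R b) \<le> (1 - t) * h a + t * h b"
        by (simp add: h_def algebra_simps add_divide_distrib diff_divide_distrib)
    qed auto
    moreover have "h y \<le> \<psi> y" if "\<psi> \<in> \<Psi>" for \<psi> y
      using fle[OF that, of "y + u"] fle[OF that, of "y - u"] sd[OF that, of y u] by (simp add: h_def)
    ultimately have "h x \<le> f x" by (intro upper) (auto simp: H_def)
    then show ?thesis by (simp add: h_def)
  qed
  then show ?thesis
    using fconv fle upper by (intro exI[of _ f]) (auto simp: H_def)
qed

section \<open>Differentiability of convex functions from a second-difference bound\<close>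

context modulus
begin

text \<open>The one-sided directional derivative of a convex function is sublinear. The
  second-difference bound, divided by the step, forces \<open>p u + p (- u) \<le> 0\<close>, which
  makes it linear; the local upper bound \<open>B\<close> makes it continuous.\<close>

lemma convex_second_difference_derivative:
  fixes f :: "'b::real_normed_vector \<Rightarrow> real"
  assumes conv: "convex_on UNIV f"
    and sd: "\<And>x u. f (x + u) + f (x - u) - 2 * f x \<le> K * (norm u * \<omega> (norm u))"
    and up: "\<And>u. norm u \<le> 1 \<Longrightarrow> f (x + u) \<le> B"
  obtains p where "bounded_linear p"
    "\<And>u. f x + p u \<le> f (x + u)" "\<And>u. f (x + u) \<le> f x + p u + K * (norm u * \<omega> (norm u))"
proof -
  define q where "q t u = (f (x + t *\<^sub>R u) - f x) / t" for t u
  define p where "p u = (INF t\<in>{0<..}. q t u)" for u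
  have cv: "f ((1 - t) *\<^sub>R a + t *\<^sub>R b) \<le> (1 - t) * f a + t * f b" if "0 \<le> t" "t \<le> 1" for t a b
    using that conv by (intro convex_onD) auto
  have qmono: "q s u \<le> q t u" if st: "0 < s" "s \<le> t" for s t u
  proof -
    have "(1 - s/t) *\<^sub>R x + (s/t) *\<^sub>R (x + t *\<^sub>R u) = x + s *\<^sub>R u"
      using st by (simp add: algebra_simps)
    then have "f (x + s *\<^sub>R u) \<le> (1 - s/t) * f x + (s/t) * f (x + t *\<^sub>R u)"
      using cv[of "s/t" x "x + t *\<^sub>R u"] st by simp
    then have "f (x + s *\<^sub>R u) - f x \<le> s * ((f (x + t *\<^sub>R u) - f x) / t)"
      by (simp add: algebra_simps diff_divide_distrib)
    then show ?thesis using st by (simp add: q_def divide_le_eq mult.commute)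
  qed
  have qsym: "0 \<le> q t u + q t (- u)" if "0 < t" for t u
  proof -
    have "2 * f x \<le> f (x + t *\<^sub>R u) + f (x - t *\<^sub>R u)"
      using cv[of "1/2" "x + t *\<^sub>R u" "x - t *\<^sub>R u"]
      by (simp add: algebra_simps flip: scaleR_left_distrib)
    then show ?thesis using that by (simp add: q_def flip: add_divide_distrib)
  qed
  have qlow: "- q 1 (- u) \<le> q t u" if "0 < t" for t u
    using qsym[of t u] qsym[of 1 u] qmono[of t 1 "- u"] qmono[of 1 t u] that by linarith
  have bdd: "bdd_below ((\<lambda>t. q t u) ` {0<..})" for u
    using qlow by (auto simp: bdd_below_def)
  have ple: "p u \<le> q t u" if "0 < t" for t u
    unfolding p_def using that by (intro cINF_lower bdd) auto
  have pge: "b \<le> p u" if "\<And>t. 0 < t \<Longrightarrow> b \<le> q t u" for b u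
    unfolding p_def using that by (intro cINF_greatest) auto
  have psub: "p (u + v) \<le> p u + p v" for u v
  proof -
    \<comment> \<open>Quotients increase with the step, so both can be shrunk to a common step
      \<open>2 * r\<close>; the midpoint of the two endpoints is then step \<open>r\<close> along
      \<open>u + v\<close>. The infima over \<open>t\<close> and \<open>s\<close> are taken one
      after the other below.\<close>
    have *: "p (u + v) \<le> q s u + q t v" if "0 < s" "0 < t" for s t
    proof -
      define r where "r = min s t / 2"
      have r: "0 < r" "2 * r \<le> s" "2 * r \<le> t" using that by (auto simp: r_def)
      have "f (x + r *\<^sub>R (u + v)) \<le> (f (x + (2*r) *\<^sub>R u) + f (x + (2*r) *\<^sub>R v)) / 2"
        using cv[of "1/2" "x + (2*r) *\<^sub>R u" "x + (2*r) *\<^sub>R v"]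
        by (simp add: algebra_simps add_divide_distrib flip: scaleR_left_distrib)
      then have "q r (u + v) \<le> q (2*r) u + q (2*r) v"
        using r by (simp add: q_def divide_le_eq flip: add_divide_distrib)
      also have "\<dots> \<le> q s u + q t v" using r by (intro add_mono qmono) auto
      finally show ?thesis using ple[of r "u + v"] r by simp
    qed
    have "p (u + v) - q s u \<le> p v" if "0 < s" for s
      using *[OF that] by (intro pge) (simp add: algebra_simps)
    then have "p (u + v) - p v \<le> p u" by (intro pge) (simp add: algebra_simps)
    then show ?thesis by simp
  qed
  have p0: "p 0 = 0" unfolding p_def by (simp add: q_def)
  have pneg: "p (- u) = - p u" for u
  proof (rule antisym)
    show "- p u \<le> p (- u)" using psub[of u "- u"] p0 by simp
    have "p u + p (- u) \<le> 0 + e" if e: "0 < e" for e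
    proof -
      \<comment> \<open>Sized so that the final product equals \<open>e\<close>; the
        \<open>+ 1\<close> also covers \<open>u = 0\<close>.\<close>
      define k where "k = max K 1 * (norm u + 1)"
      have k: "0 < k" unfolding k_def by (intro mult_pos_pos) (auto intro: add_nonneg_pos)
      obtain d where d: "0 < d" "\<And>t. 0 \<le> t \<Longrightarrow> t \<le> d \<Longrightarrow> \<omega> t < e / k"
        using modulus_small[of "e / k"] e k by auto
      define t where "t = d / (norm u + 1)"
      have n1: "0 < norm u + 1" by (intro add_nonneg_pos) auto
      have t: "0 < t" "t * norm u \<le> d"
        using d n1 by (auto simp: t_def field_simps)
      have "q t u + q t (- u) = (f (x + t *\<^sub>R u) + f (x - t *\<^sub>R u) - 2 * f x) / t"
        by (simp add: q_def flip: add_divide_distrib)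
      also have "\<dots> \<le> K * (norm u * \<omega> (t * norm u))"
        using sd[of x "t *\<^sub>R u"] t by (simp add: divide_le_eq ac_simps)
      also have "\<dots> \<le> max K 1 * ((norm u + 1) * (e / k))"
        using d(2)[of "t * norm u"] t e k
        by (intro mult_mono) (auto intro!: mult_nonneg_nonneg modulus_nonneg)
      also have "\<dots> = e" using k by (auto simp: k_def)
      finally show ?thesis using ple[OF t(1), of u] ple[OF t(1), of "- u"] by linarith
    qed
    then have "p u + p (- u) \<le> 0" by (rule field_le_epsilon)
    then show "p (- u) \<le> - p u" by simp
  qed
  have padd: "p (u + v) = p u + p v" for u v
    using psub[of u v] psub[of "- u" "- v"] pneg[of u] pneg[of v] pneg[of "u + v"] by simp
  have pscale_pos: "p (c *\<^sub>R u) = c * p u" if c: "0 < c" for c u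
  proof (rule antisym)
    have q: "q t (c *\<^sub>R u) = c * q (t * c) u" if "0 < t" for t
      using that c by (simp add: q_def)
    have "p (c *\<^sub>R u) / c \<le> p u"
    proof (rule pge)
      fix t :: real assume t: "0 < t"
      have "p (c *\<^sub>R u) \<le> c * q t u"
        using ple[of "t / c" "c *\<^sub>R u"] q[of "t / c"] t c by simp
      then show "p (c *\<^sub>R u) / c \<le> q t u" using c by (simp add: divide_le_eq mult.commute)
    qed
    then show "p (c *\<^sub>R u) \<le> c * p u" using c by (simp add: divide_le_eq mult.commute)
    show "c * p u \<le> p (c *\<^sub>R u)"
      using q ple c by (intro pge) auto
  qed
  have pscale: "p (c *\<^sub>R u) = c * p u" for c u
  proof (cases c "0 :: real" rule: linorder_cases)
    case less
    then show ?thesis using pscale_pos[of "- c" u] pneg[of "c *\<^sub>R u"] by simp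
  qed (use pscale_pos p0 in auto)
  have lower: "f x + p u \<le> f (x + u)" for u
    using ple[of 1 u] by (simp add: q_def)
  define b where "b = max (B - f x) 0"
  have "\<bar>p u\<bar> \<le> norm u * b" for u
  proof -
    have le: "p v \<le> norm v * b" for v
    proof (cases "v = 0")
      case False
      have "p (sgn v) \<le> b" using lower[of "sgn v"] up[of "sgn v"] False by (auto simp: b_def norm_sgn)
      then have "norm v * p (sgn v) \<le> norm v * b" by (intro mult_left_mono) auto
      moreover have "norm v *\<^sub>R sgn v = v" using False by (simp add: sgn_div_norm)
      ultimately show ?thesis using pscale[of "norm v" "sgn v"] by simp
    qed (simp add: p0)
    show ?thesis using le[of u] le[of "- u"] pneg[of u] by simp
  qed
  then have "bounded_linear p"
    using padd pscale by (intro bounded_linear_intro[of p b]) auto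
  moreover have "f (x + u) \<le> f x + p u + K * (norm u * \<omega> (norm u))" for u
    using sd[of x u] lower[of "- u"] pneg[of u] by simp
  ultimately show thesis using lower that by blast
qed

text \<open>Differentiability at \<open>x\<close> is the two-sided tangent estimate. For the modulus
  of the derivative, the value at one further point is bounded below from \<open>x\<close> and above
  through \<open>y\<close>.\<close>

lemma C1w_of_convex_second_difference:
  fixes f :: "'b::real_normed_vector \<Rightarrow> real"
  assumes conv: "convex_on UNIV f" and K: "0 < K"
    and sd: "\<And>x u. f (x + u) + f (x - u) - 2 * f x \<le> K * (norm u * \<omega> (norm u))"
    and up: "\<And>x. \<exists>B. \<forall>u. norm u \<le> 1 \<longrightarrow> f (x + u) \<le> B"
  shows "\<exists>f'. C1w_with \<omega> f f'"
proof -
  have "\<exists>p. bounded_linear p \<and> (\<forall>u. f x + p u \<le> f (x + u) \<and>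
      f (x + u) \<le> f x + p u + K * (norm u * \<omega> (norm u)))" for x
    using up[of x] convex_second_difference_derivative[OF conv sd, of x] by metis
  then obtain p where p: "\<And>x. bounded_linear (p x)" "\<And>x u. f x + p x u \<le> f (x + u)"
    "\<And>x u. f (x + u) \<le> f x + p x u + K * (norm u * \<omega> (norm u))"
    by metis
  define f' where "f' x = Blinfun (p x)" for x
  have f': "blinfun_apply (f' x) = p x" for x
    using p(1) by (simp add: f'_def bounded_linear_Blinfun_apply)
  have "(f has_derivative blinfun_apply (f' x)) (at x)" for x
    unfolding f' using p(2,3)[of x] K
    by (intro has_derivative_of_modulus_bound[OF p(1), where \<epsilon> = 1 and K = K])
       (auto simp: abs_le_iff algebra_simps intro: order_trans[OF _ p(2)] mult_nonneg_nonneg modulus_nonneg)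
  moreover have "norm (f' x - f' y) \<le> (2 * K) * \<omega> (norm (x - y))" for x y
  proof (cases "x = y")
    case False
    define t where "t = norm (x - y)"
    have t: "0 < t" using False by (simp add: t_def)
    \<comment> \<open>Choosing \<open>v\<close> as long as \<open>x - y\<close> makes the errors of
      the steps from \<open>x\<close> to \<open>y\<close> and from \<open>y\<close> to
      \<open>y + v\<close> equal. Linearity then rescales \<open>v\<close> to an arbitrary
      vector.\<close>
    have le: "p x v - p y v \<le> 2 * K * (t * \<omega> t)" if v: "norm v = t" for v
    proof -
      have "f x + p x (y - x + v) \<le> f (y + v)" using p(2)[of x "y - x + v"] by (simp add: algebra_simps)
      moreover have "p x (y - x + v) = p x (y - x) + p x v"
        using p(1) by (simp add: bounded_linear.linear linear_add)
      moreover have "f y \<le> f x + p x (y - x) + K * (t * \<omega> t)"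
        using p(3)[of x "y - x"] by (simp add: t_def norm_minus_commute)
      ultimately show ?thesis using p(3)[of y v] v by simp
    qed
    show ?thesis
    proof (rule norm_blinfun_bound)
      fix u :: 'b
      show "norm (blinfun_apply (f' x - f' y) u) \<le> 2 * K * \<omega> (norm (x - y)) * norm u"
      proof (cases "u = 0")
        case u: False
        define v where "v = (t / norm u) *\<^sub>R u"
        have v: "norm v = t" using u t by (simp add: v_def)
        have "p z v = (t / norm u) * p z u" for z
          using p(1)[of z] by (simp add: v_def bounded_linear.linear linear_cmul)
        moreover have "p z (- v) = - p z v" for z
          using p(1)[of z] by (simp add: bounded_linear.linear linear_neg)
        ultimately have "(t / norm u) * \<bar>p x u - p y u\<bar> \<le> 2 * K * (t * \<omega> t)"
          using le[of v] le[of "- v"] v t u by (simp add: abs_if right_diff_distrib diff_divide_distrib)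
        then have "t * \<bar>p x u - p y u\<bar> \<le> t * (2 * K * \<omega> t * norm u)"
          using u t by (simp add: field_simps)
        then show ?thesis using t by (simp add: f' blinfun.diff_left t_def)
      qed simp
    qed (use K modulus_nonneg in auto)
  qed simp
  ultimately show ?thesis using K unfolding C1w_with_def by (intro exI[of _ f']) (auto intro!: exI[of _ "2*K"])
qed

end

section \<open>Convex bodies with smooth boundary\<close>

lemma has_derivative_pos_increase:
  fixes f :: "'b::real_normed_vector \<Rightarrow> real"
  assumes "(f has_derivative D) (at x)" "0 < D k"
  shows "\<exists>d>0. \<forall>t. 0 < t \<longrightarrow> t < d \<longrightarrow> f x < f (x + t *\<^sub>R k)"
proof -
  have "((\<lambda>t. x + t *\<^sub>R k) has_derivative (\<lambda>t. t *\<^sub>R k)) (at (0::real))"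
    by (auto intro!: derivative_eq_intros)
  from has_derivative_compose[OF this, of f D]
  have "((\<lambda>t. f (x + t *\<^sub>R k)) has_derivative (\<lambda>t. D (t *\<^sub>R k))) (at 0)" using assms by simp
  moreover have "D (t *\<^sub>R k) = D k * t" for t
    using has_derivative_linear[OF assms(1)] by (simp add: linear_cmul)
  ultimately have "((\<lambda>t. f (x + t *\<^sub>R k)) has_real_derivative D k) (at 0)"
    by (simp add: has_field_derivative_def)
  from DERIV_pos_inc_right[OF this] assms(2) show ?thesis by auto
qed

lemma has_derivative_nonpos_direction:
  fixes f :: "'b::real_normed_vector \<Rightarrow> real"
  assumes "(f has_derivative D) (at x)" "convex V" "x \<in> V" "y \<in> V" "\<And>z. z \<in> V \<Longrightarrow> f z \<le> f x"
  shows "D (y - x) \<le> 0"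
proof (rule ccontr)
  assume "\<not> ?thesis"
  then obtain d where d: "d > 0" "\<And>t. 0 < t \<Longrightarrow> t < d \<Longrightarrow> f x < f (x + t *\<^sub>R (y - x))"
    using has_derivative_pos_increase[OF assms(1), of "y - x"] by auto
  define t where "t = min (d/2) 1"
  have t: "0 < t" "t < d" "t \<le> 1" using d by (auto simp: t_def)
  have "(1 - t) *\<^sub>R x + t *\<^sub>R y \<in> V" using assms t by (intro convexD_alt) auto
  then have "x + t *\<^sub>R (y - x) \<in> V" by (simp add: algebra_simps)
  then show False using assms(5) d(2)[of t] t by fastforce
qed

text \<open>Passes from gradients to unit normals: replacing \<open>b\<close> by \<open>a\<close>
  costs \<open>\<bar>a - b\<bar>\<close>, which the reverse triangle inequality bounds by the same
  right-hand norm.\<close>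

lemma norm_unit_diff_le:
  fixes m n :: "'b::real_normed_vector"
  assumes "norm m = 1" "norm n = 1" "0 < a" "0 < b"
  shows "a * norm (m - n) \<le> 2 * norm (a *\<^sub>R m - b *\<^sub>R n)"
proof -
  have "\<bar>a - b\<bar> \<le> norm (a *\<^sub>R m - b *\<^sub>R n)"
    using norm_triangle_ineq3[of "a *\<^sub>R m" "b *\<^sub>R n"] assms by simp
  moreover have "a *\<^sub>R (m - n) = (a *\<^sub>R m - b *\<^sub>R n) + (b - a) *\<^sub>R n"
    by (simp add: algebra_simps)
  then have "norm (a *\<^sub>R (m - n)) \<le> norm (a *\<^sub>R m - b *\<^sub>R n) + norm ((b - a) *\<^sub>R n)"
    by (metis norm_triangle_ineq)
  ultimately show ?thesis using assms by simp
qed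

lemma norm_riesz_le:
  fixes v :: "'b::real_inner"
  assumes "\<And>h. blinfun_apply D h = inner v h"
  shows "norm v \<le> norm D"
proof (cases "v = 0")
  case False
  have "norm v * norm v = blinfun_apply D v"
    using assms by (simp add: power2_norm_eq_inner[symmetric] power2_eq_square)
  also have "\<dots> \<le> norm D * norm v" using norm_blinfun[of D v] by simp
  finally show ?thesis using False by simp
qed simp

locale smooth_convex_body = modulus \<omega> for \<omega> +
  fixes V :: "'a::real_inner set" and N :: "'a \<Rightarrow> 'a"
  assumes body: "convex_body V"
    and hypersurface: "C1_hypersurface (frontier V)"
    and outer: "outer_unit_normal V N"
begin

abbreviation S :: "'a set" where "S \<equiv> frontier V"

lemma closed_V: "closed V" and convex_V: "convex V" and interior_nonempty: "interior V \<noteq> {}"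
  using body by (auto simp: convex_body_def)

lemma norm_N: "x \<in> S \<Longrightarrow> norm (N x) = 1"
  and N_le: "x \<in> S \<Longrightarrow> y \<in> V \<Longrightarrow> inner (N x) (y - x) \<le> 0"
  using outer by (auto simp: outer_unit_normal_def)

lemma S_subset: "x \<in> S \<Longrightarrow> x \<in> V"
  using closed_V frontier_subset_closed by blast

text \<open>A quantitative support inequality: the point of the ball farthest in direction
  \<open>N x\<close> is approached by \<open>z + s *\<^sub>R N x\<close> with
  \<open>s < \<rho>\<close>.\<close>

lemma N_le_ball:
  assumes "x \<in> S" "ball z \<rho> \<subseteq> V" "0 < \<rho>"
  shows "inner (N x) (z - x) \<le> - \<rho>"
proof (rule ccontr)
  assume "\<not> ?thesis"
  then have "max 0 (- inner (N x) (z - x)) < \<rho>" using assms by simp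
  then obtain s where s: "max 0 (- inner (N x) (z - x)) < s" "s < \<rho>" using dense by blast
  have "z + s *\<^sub>R N x \<in> ball z \<rho>" using s norm_N[OF assms(1)] by (simp add: dist_norm)
  then have "inner (N x) (z + s *\<^sub>R N x - x) \<le> 0" using N_le assms by blast
  moreover have "inner (N x) (z + s *\<^sub>R N x - x) = inner (N x) (z - x) + s * (norm (N x))\<^sup>2"
    by (simp add: algebra_simps power2_norm_eq_inner)
  ultimately show False using s norm_N[OF assms(1)] by simp
qed

lemma N_less_interior:
  assumes "x \<in> S" "z \<in> interior V"
  shows "inner (N x) (z - x) < 0"
proof -
  obtain \<rho> where "\<rho> > 0" "ball z \<rho> \<subseteq> V" using assms(2) by (auto simp: mem_interior)
  then show ?thesis using N_le_ball[OF assms(1)] by fastforce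
qed

text \<open>A ball of radius \<open>\<rho>\<close> about \<open>z\<close> is carried by the
  homothety with centre \<open>x\<close> and ratio \<open>t\<close> to a ball of radius
  \<open>t * \<rho>\<close>, still inside \<open>V\<close> by convexity.\<close>

lemma segment_interior:
  assumes z: "z \<in> interior V" and x: "x \<in> V" and t: "0 < t" "t \<le> 1"
  shows "(1 - t) *\<^sub>R x + t *\<^sub>R z \<in> interior V"
proof -
  obtain \<rho> where \<rho>: "\<rho> > 0" "ball z \<rho> \<subseteq> V" using z by (auto simp: mem_interior)
  have "ball ((1 - t) *\<^sub>R x + t *\<^sub>R z) (t * \<rho>) \<subseteq> V"
  proof
    fix w assume w: "w \<in> ball ((1 - t) *\<^sub>R x + t *\<^sub>R z) (t * \<rho>)"
    define z' where "z' = (1 / t) *\<^sub>R (w - (1 - t) *\<^sub>R x)"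
    have "z' - z = (1 / t) *\<^sub>R (w - ((1 - t) *\<^sub>R x + t *\<^sub>R z))"
      using t by (simp add: z'_def algebra_simps)
    then have "norm (z' - z) < \<rho>"
      using w t by (simp add: dist_norm norm_minus_commute divide_less_eq mult.commute)
    then have "z' \<in> V" using \<rho> by (auto simp: dist_norm norm_minus_commute)
    then have "(1 - t) *\<^sub>R x + t *\<^sub>R z' \<in> V" using convex_V x t by (intro convexD_alt) auto
    moreover have "(1 - t) *\<^sub>R x + t *\<^sub>R z' = w" using t by (simp add: z'_def)
    ultimately show "w \<in> V" by simp
  qed
  then show ?thesis using \<rho> t by (intro interiorI[OF open_ball, rotated]) auto
qed

lemma interior_approx:
  assumes "x \<in> V" "0 < e"
  shows "\<exists>z\<in>interior V. norm (z - x) < e"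
proof -
  obtain c where c: "c \<in> interior V" using interior_nonempty by auto
  define n where "n = norm (c - x) + 1"
  have n: "0 < n" "norm (c - x) < n" by (auto simp: n_def intro: add_nonneg_pos)
  define t where "t = min 1 (e / n)"
  have t: "0 < t" "t \<le> 1" "t \<le> e / n" using assms n by (auto simp: t_def)
  have "norm ((1 - t) *\<^sub>R x + t *\<^sub>R c - x) = t * norm (c - x)"
    using t by (simp add: algebra_simps flip: scaleR_diff_right)
  also have "\<dots> < t * n" using t n by simp
  also have "\<dots> \<le> e" using t n by (simp add: le_divide_eq)
  finally show ?thesis using segment_interior[OF c assms(1) t(1,2)] by blast
qed

text \<open>Where the segment leaves \<open>V\<close>, the interior point \<open>z\<close> is
  strictly on the negative side of the supporting hyperplane, so \<open>N y\<close> is strictly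
  positive along \<open>p - z\<close>, and \<open>p - y\<close> is a nonnegative multiple of that
  direction.\<close>

lemma crossing_point:
  assumes z: "z \<in> interior V" and p: "p \<notin> interior V"
  obtains y where "y \<in> S" "y \<in> closed_segment z p" "0 \<le> inner (N y) (p - y)"
    "p \<notin> V \<Longrightarrow> 0 < inner (N y) (p - y)"
proof -
  have "closed_segment z p \<inter> S \<noteq> {}"
  proof (cases "p \<in> V")
    case True
    then have "p \<in> S" using p closed_V by (simp add: frontier_def)
    then show ?thesis by auto
  next
    case False
    then show ?thesis using z interior_subset
      by (intro connected_Int_frontier) auto
  qed
  then obtain y where y: "y \<in> S" and "y \<in> closed_segment z p" by auto
  then obtain l where l: "0 \<le> l" "l \<le> 1" "y = (1 - l) *\<^sub>R z + l *\<^sub>R p"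
    by (auto simp: in_segment)
  have "z - y = (- l) *\<^sub>R (p - z)" and py: "p - y = (1 - l) *\<^sub>R (p - z)"
    using l(3) by (simp_all add: algebra_simps)
  then have "0 < l * inner (N y) (p - z)" using N_less_interior[OF y z] by simp
  then have pos: "0 < inner (N y) (p - z)" using l(1) by (simp add: zero_less_mult_iff)
  show thesis
  proof
    show "y \<in> S" by fact
    show "y \<in> closed_segment z p" using l by (auto simp: in_segment)
    show "0 \<le> inner (N y) (p - y)" using py pos l by simp
    assume "p \<notin> V"
    then have "l \<noteq> 1" using l(3) S_subset[OF y] by auto
    then show "0 < inner (N y) (p - y)" using py pos l by simp
  qed
qed

text \<open>Any functional that is nonpositive on \<open>V - x\<close> vanishes on the kernel of the
  derivative of a local equation \<open>g\<close> of \<open>S\<close>, so it is a multiple of that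
  derivative. Applying this to \<open>L\<close> and to \<open>inner (N x)\<close> gives
  proportionality; an interior point fixes the sign.\<close>

lemma normal_functional_unique:
  assumes x: "x \<in> S" and L: "bounded_linear L" and Lle: "\<And>y. y \<in> V \<Longrightarrow> L (y - x) \<le> 0"
  shows "\<exists>c\<ge>0. \<forall>h. L h = c * inner (N x) h"
proof -
  obtain U and g :: "'a \<Rightarrow> real" and g' where U: "open U" "x \<in> U"
    and der: "\<And>y. y \<in> U \<Longrightarrow> (g has_derivative blinfun_apply (g' y)) (at y)"
    and g'0: "g' x \<noteq> 0" and SU: "S \<inter> U = {y\<in>U. g y = 0}"
    using hypersurface[unfolded C1_hypersurface_def, rule_format, OF x] by (elim exE conjE) blast
  define D where "D = blinfun_apply (g' x)"
  have lin: "linear D" unfolding D_def by (simp add: blinfun.bounded_linear_right bounded_linear.linear)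
  obtain e' where "D e' \<noteq> 0" using g'0 unfolding D_def using blinfun_eqI[of "g' x" 0] by auto
  define e where "e = (1 / D e') *\<^sub>R e'"
  have De: "D e = 1" using \<open>D e' \<noteq> 0\<close> lin by (simp add: e_def linear_cmul)
  have gx: "g x = 0" using SU x U by auto
  \<comment> \<open>Directions tangent to \<open>S\<close> are limits of directions pointing to nearby points of \<open>S\<close>.\<close>
  have tangent_le: "l h \<le> 0" if l: "bounded_linear l" "\<And>y. y \<in> V \<Longrightarrow> l (y - x) \<le> 0" and h: "D h = 0"
    for l :: "'a \<Rightarrow> real" and h
  proof (rule ccontr)
    assume "\<not> ?thesis"
    then have lh: "0 < l h" by simp
    have ll: "linear l" using l(1) by (simp add: bounded_linear.linear)
    \<comment> \<open>Small enough that adding \<open>s *\<^sub>R e\<close> with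
      \<open>\<bar>s\<bar> \<le> \<epsilon>\<close> to \<open>h\<close> cannot destroy the
      positivity of \<open>l\<close>.\<close>
    define \<epsilon> where "\<epsilon> = l h / (2 * (\<bar>l e\<bar> + 1))"
    have \<epsilon>: "0 < \<epsilon>" using lh by (auto simp: \<epsilon>_def intro!: divide_pos_pos add_nonneg_pos)
    have \<epsilon>e: "\<epsilon> * \<bar>l e\<bar> < l h"
    proof -
      have "\<epsilon> * \<bar>l e\<bar> < \<epsilon> * (2 * (\<bar>l e\<bar> + 1))" using \<epsilon> by (intro mult_strict_left_mono) auto
      also have "\<dots> = l h" by (simp add: \<epsilon>_def)
      finally show ?thesis .
    qed
    obtain d1 where d1: "d1 > 0" "\<And>t. 0 < t \<Longrightarrow> t < d1 \<Longrightarrow> g x < g (x + t *\<^sub>R (h + \<epsilon> *\<^sub>R e))"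
      using has_derivative_pos_increase[OF der[OF U(2)], of "h + \<epsilon> *\<^sub>R e"] lin De h \<epsilon>
      by (auto simp: D_def linear_add linear_cmul)
    have "((\<lambda>y. - g y) has_derivative (\<lambda>v. - D v)) (at x)"
      using der[OF U(2)] unfolding D_def by (rule has_derivative_minus)
    then obtain d2 where d2: "d2 > 0" "\<And>t. 0 < t \<Longrightarrow> t < d2 \<Longrightarrow> - g x < - g (x + t *\<^sub>R (h - \<epsilon> *\<^sub>R e))"
      using has_derivative_pos_increase[of "\<lambda>y. - g y" "\<lambda>v. - D v" x "h - \<epsilon> *\<^sub>R e"] lin De h \<epsilon>
      by (auto simp: linear_diff linear_cmul)
    obtain r where r: "r > 0" "ball x r \<subseteq> U" using U by (auto simp: open_contains_ball)
    define n where "n = norm h + \<epsilon> * norm e + 1"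
    have n: "0 < n" using \<epsilon> by (auto simp: n_def intro!: add_nonneg_pos)
    \<comment> \<open>Below \<open>d1\<close> and \<open>d2\<close>, \<open>g\<close> has opposite
      signs at the two perturbed points, so the intermediate value theorem gives a point of
      \<open>S\<close> between them; the bound \<open>r / n\<close> keeps the whole segment in
      \<open>U\<close>.\<close>
    define t where "t = min (min d1 d2 / 2) (r / n)"
    have t: "0 < t" "t < d1" "t < d2" using d1(1) d2(1) r(1) n by (auto simp: t_def)
    have "t \<le> r / n" by (simp add: t_def)
    then have tn: "t * n \<le> r" using n by (simp add: le_divide_eq)
    have inU: "x + t *\<^sub>R (h + s *\<^sub>R e) \<in> U" if "s \<in> {-\<epsilon>..\<epsilon>}" for s
    proof -
      have "norm (h + s *\<^sub>R e) \<le> norm h + \<bar>s\<bar> * norm e" using norm_triangle_ineq[of h "s *\<^sub>R e"] by simp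
      also have "\<bar>s\<bar> * norm e \<le> \<epsilon> * norm e" using that by (intro mult_right_mono) auto
      also have "norm h + \<epsilon> * norm e < n" by (simp add: n_def)
      finally have "t * norm (h + s *\<^sub>R e) < t * n" using t by simp
      then have "t * norm (h + s *\<^sub>R e) < r" using tn by simp
      then show ?thesis using r t by (intro subsetD[OF r(2)]) (simp add: dist_norm)
    qed
    have "\<exists>s\<ge>-\<epsilon>. s \<le> \<epsilon> \<and> g (x + t *\<^sub>R (h + s *\<^sub>R e)) = 0"
    proof (rule IVT')
      show "continuous_on {- \<epsilon>..\<epsilon>} (\<lambda>s. g (x + t *\<^sub>R (h + s *\<^sub>R e)))"
      proof (rule continuous_on_compose2[of U g])
        show "continuous_on U g"
          using der by (meson has_derivative_continuous continuous_at_imp_continuous_on)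
      qed (use inU in \<open>auto intro!: continuous_intros\<close>)
    qed (use d1(2)[of t] d2(2)[of t] t gx \<epsilon> in auto)
    then obtain s where s: "- \<epsilon> \<le> s" "s \<le> \<epsilon>" "g (x + t *\<^sub>R (h + s *\<^sub>R e)) = 0" by auto
    then have "x + t *\<^sub>R (h + s *\<^sub>R e) \<in> S" using SU inU by auto
    then have "t * (l h + s * l e) \<le> 0"
      using l(2)[of "x + t *\<^sub>R (h + s *\<^sub>R e)"] S_subset ll by (simp add: linear_add linear_cmul)
    then have "l h + s * l e \<le> 0" using t by (simp add: mult_le_0_iff)
    moreover have "\<bar>s * l e\<bar> \<le> \<epsilon> * \<bar>l e\<bar>" using s by (auto simp: abs_mult intro!: mult_right_mono)
    ultimately show False using \<epsilon>e by linarith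
  qed
  \<comment> \<open>\<open>h - D h *\<^sub>R e\<close> and its negative both lie in the kernel of
    \<open>D\<close>, so \<open>tangent_le\<close> applied to each shows that \<open>l\<close>
    vanishes there.\<close>
  have rep: "l h = D h * l e" if l: "bounded_linear l" "\<And>y. y \<in> V \<Longrightarrow> l (y - x) \<le> 0" for l :: "'a \<Rightarrow> real" and h
  proof -
    have ll: "linear l" using l(1) by (simp add: bounded_linear.linear)
    have "D (h - D h *\<^sub>R e) = 0" "D (- (h - D h *\<^sub>R e)) = 0"
      using lin De by (simp_all add: linear_diff linear_cmul linear_neg)
    then have "l (h - D h *\<^sub>R e) \<le> 0" "l (- (h - D h *\<^sub>R e)) \<le> 0" using tangent_le[OF l] by blast+
    then have "l (h - D h *\<^sub>R e) = 0" using ll by (simp only: linear_neg)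
    then show ?thesis using ll by (simp add: linear_diff linear_cmul)
  qed
  have N: "inner (N x) h = D h * inner (N x) e" for h
    using N_le[OF x] by (intro rep[of "inner (N x)"]) (auto intro: bounded_linear_inner_right)
  have ne: "inner (N x) e \<noteq> 0" using N[of "N x"] norm_N[OF x] by auto
  define c where "c = L e / inner (N x) e"
  have eq: "L h = c * inner (N x) h" for h
    using rep[OF L Lle, of h] N[of h] ne by (simp add: c_def)
  obtain z where z: "z \<in> interior V" using interior_nonempty by auto
  have "c * inner (N x) (z - x) \<le> 0" using Lle[of z] eq z interior_subset by auto
  then have "0 \<le> c" using N_less_interior[OF x z] by (simp add: mult_le_0_iff)
  then show ?thesis using eq by blast
qed

end

section \<open>Implications among (1), (2), (3), and the convex extension (4)\<close>

context smooth_convex_body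
begin

lemma normal_modulus_imp_inner_bound:
  assumes M: "0 < M" "\<And>x y. x \<in> S \<Longrightarrow> y \<in> S \<Longrightarrow> norm (N x - N y) \<le> M * \<omega> (norm (x - y))"
    and x: "x \<in> S" and p: "p \<notin> interior V"
  shows "inner (N x) (x - p) \<le> M * \<phi> (2 * norm (x - p))"
proof (cases "p = x")
  case False
  define t where "t = norm (x - p)"
  have t: "0 < t" using False by (simp add: t_def)
  \<comment> \<open>With \<open>z\<close> this close to \<open>x\<close>, the whole segment to
    \<open>p\<close>, and so the crossing point, stays in \<open>cball x t\<close>.\<close>
  obtain z where z: "z \<in> interior V" "norm (z - x) < t" using interior_approx S_subset x t by blast
  obtain y where y: "y \<in> S" "y \<in> closed_segment z p" "0 \<le> inner (N y) (p - y)"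
    using crossing_point[OF z(1) p] by metis
  have "closed_segment z p \<subseteq> cball x t"
    using z(2) by (intro closed_segment_subset) (auto simp: dist_norm norm_minus_commute t_def)
  then have yx: "norm (x - y) \<le> t" using y by (auto simp: dist_norm)
  have "0 \<le> inner (N y) (p - x)"
    using y(3) N_le[OF y(1) S_subset[OF x]] by (simp add: inner_diff_right)
  then have "inner (N x) (x - p) \<le> inner (N x - N y) (x - p)"
    by (simp add: inner_diff_left inner_diff_right)
  also have "\<dots> \<le> norm (N x - N y) * t" unfolding t_def by (rule norm_cauchy_schwarz)
  also have "\<dots> \<le> (M * \<omega> t) * t"
    using M(2)[OF x y(1)] modulus_mono[OF _ yx] M(1) t
    by (intro mult_right_mono) (auto intro: order_trans mult_left_mono)
  also have "\<dots> \<le> M * \<phi> (2 * t)" using phi_double_ge[of t] t M(1) by (simp add: ac_simps)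
  finally show ?thesis by (simp add: t_def)
qed simp

text \<open>Doubling the constant contradicts the previous bound for points off the interior.
  Landing in the interior, not merely in \<open>V\<close>, is what leaves \<open>x\<close> as the
  only point of \<open>S\<close> in the region.\<close>

lemma normal_modulus_imp_inner_region:
  assumes M: "0 < M" "\<And>x y. x \<in> S \<Longrightarrow> y \<in> S \<Longrightarrow> norm (N x - N y) \<le> M * \<omega> (norm (x - y))"
    and x: "x \<in> S" and p: "2 * M * \<phi> (2 * norm (x - p)) \<le> inner (N x) (x - p)" and "p \<noteq> x"
  shows "p \<in> interior V"
proof (rule ccontr)
  assume "p \<notin> interior V"
  from normal_modulus_imp_inner_bound[OF M x this] p
  have "M * \<phi> (2 * norm (x - p)) \<le> 0" by simp
  then show False using phi_double_pos[of "norm (x - p)"] M(1) \<open>p \<noteq> x\<close> by (simp add: mult_le_0_iff)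
qed

lemma inner_region_imp_monotone:
  assumes M: "0 < M" "\<And>x p. x \<in> S \<Longrightarrow> M * \<phi> (2 * norm (x - p)) \<le> inner (N x) (x - p) \<Longrightarrow> p \<in> V"
    and x: "x \<in> S" and y: "y \<in> S"
  shows "norm (N x - N y) / 2 * modinv \<omega> (norm (N x - N y) / (4 * (2 * M))) \<le> inner (N y) (y - x)"
proof (cases "N x = N y")
  case True
  then show ?thesis using N_le[OF y S_subset[OF x]] by (simp add: inner_diff_right)
next
  case False
  define \<delta> where "\<delta> = norm (N x - N y)"
  \<comment> \<open>This gives \<open>\<omega> s = \<delta> / (8 * M)\<close>, the size at which
    \<open>M * \<phi> (2 * s) \<le> 4 * M * s * \<omega> s = s * \<delta> / 2\<close>.\<close>
  define s where "s = modinv \<omega> (\<delta> / (4 * (2 * M)))"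
  have \<delta>: "0 < \<delta>" using False by (simp add: \<delta>_def)
  have s: "0 \<le> s" "\<omega> s = \<delta> / (8 * M)"
    using modinv_nonneg modulus_modinv \<delta> M(1) by (auto simp: s_def)
  have "\<delta>\<^sup>2 = 2 - 2 * inner (N x) (N y)"
    using norm_N[OF x] norm_N[OF y] unfolding \<delta>_def
    by (simp add: power2_norm_eq_inner inner_diff_left inner_diff_right inner_commute norm_eq_1)
  then have ip: "inner (N x) (N y) = 1 - \<delta>\<^sup>2 / 2" by linarith
  have self: "inner (N z) (N z) = 1" if "z \<in> S" for z
    using norm_N[OF that] by (simp add: norm_eq_1)
  \<comment> \<open>A step of length \<open>s\<close> along the unit vector from \<open>N x\<close>
    to \<open>N y\<close>. It goes inward by \<open>s * \<delta> / 2\<close> as seen from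
    \<open>N x\<close> and outward by the same amount as seen from \<open>N y\<close>.\<close>
  define p where "p = x + (s / \<delta>) *\<^sub>R (N y - N x)"
  have np: "norm (x - p) = s" using s \<delta> by (simp add: p_def \<delta>_def norm_minus_commute)
  have "inner (N x) (x - p) = s / \<delta> * (inner (N x) (N x) - inner (N x) (N y))"
    by (simp add: p_def inner_diff_right algebra_simps)
  then have Nx: "inner (N x) (x - p) = s * \<delta> / 2"
    using \<delta> ip self[OF x] by (simp add: power2_eq_square)
  have "inner (N y) (p - x) = s / \<delta> * (inner (N y) (N y) - inner (N x) (N y))"
    by (simp add: p_def inner_diff_right inner_commute)
  then have Ny: "inner (N y) (p - x) = s * \<delta> / 2"
    using \<delta> ip self[OF y] by (simp add: power2_eq_square)
  have "M * \<phi> (2 * s) \<le> M * (4 * (s * \<omega> s))" using phi_double_le[of s] s(1) M(1) by (intro mult_left_mono) auto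
  also have "\<dots> = s * \<delta> / 2" using s M(1) by (simp add: field_simps)
  finally have "p \<in> V" using M(2)[OF x, of p] np Nx by simp
  then have "inner (N y) (p - y) \<le> 0" using N_le y by blast
  then have "s * \<delta> / 2 \<le> inner (N y) (y - x)" using Ny by (simp add: inner_diff_right)
  then show ?thesis by (simp add: s_def \<delta>_def mult.commute)
qed

lemma monotone_imp_normal_modulus:
  assumes M: "0 < M" "\<And>x y. x \<in> S \<Longrightarrow> y \<in> S \<Longrightarrow>
      norm (N x - N y) / 2 * modinv \<omega> (norm (N x - N y) / (4 * M)) \<le> inner (N y) (y - x)"
    and x: "x \<in> S" and y: "y \<in> S"
  shows "norm (N x - N y) \<le> 4 * M * \<omega> (norm (x - y))"
proof (cases "N x = N y")
  case True
  then show ?thesis using M(1) modulus_nonneg by simp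
next
  case False
  define \<delta> where "\<delta> = norm (N x - N y)"
  have \<delta>: "0 < \<delta>" using False by (simp add: \<delta>_def)
  have "\<delta> * modinv \<omega> (\<delta> / (4 * M)) \<le> inner (N y) (y - x) + inner (N x) (x - y)"
    using M(2)[OF x y] M(2)[OF y x] by (simp add: \<delta>_def norm_minus_commute)
  also have "\<dots> = inner (N x - N y) (x - y)" by (simp add: inner_diff_left inner_diff_right)
  also have "\<dots> \<le> \<delta> * norm (x - y)" unfolding \<delta>_def by (rule norm_cauchy_schwarz)
  finally have "modinv \<omega> (\<delta> / (4 * M)) \<le> norm (x - y)" using \<delta> by simp
  then have "\<delta> / (4 * M) \<le> \<omega> (norm (x - y))" using \<delta> M(1) by (subst (asm) modinv_le_iff) auto
  then show ?thesis using M(1) by (simp add: \<delta>_def field_simps)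
qed

text \<open>Turning the normal from \<open>N y\<close> to \<open>N y'\<close> gains at most
  \<open>\<delta> * t\<close>, while (3) costs \<open>\<delta> * s / 2\<close>. If
  \<open>s \<ge> 2 * t\<close> the cost wins; otherwise
  \<open>\<delta> \<le> 8 * M * \<omega> t\<close>, and \<open>phi_ge\<close> turns 8 into
  32.\<close>

lemma monotone_imp_tangent_bowl:
  assumes M: "0 < M" "\<And>x y. x \<in> S \<Longrightarrow> y \<in> S \<Longrightarrow>
      norm (N x - N y) / 2 * modinv \<omega> (norm (N x - N y) / (4 * M)) \<le> inner (N y) (y - x)"
    and y: "y \<in> S" and y': "y' \<in> S"
  shows "inner (N y') (x - y') \<le> inner (N y) (x - y) + 32 * M * \<phi> (norm (x - y))"
proof -
  define \<delta> where "\<delta> = norm (N y - N y')"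
  define t where "t = norm (x - y)"
  define s where "s = modinv \<omega> (\<delta> / (4 * M))"
  have nn: "0 \<le> \<delta>" "0 \<le> t" by (auto simp: \<delta>_def t_def)
  have "inner (N y' - N y) (x - y) \<le> norm (N y' - N y) * norm (x - y)" by (rule norm_cauchy_schwarz)
  then have "inner (N y') (x - y') - inner (N y) (x - y) \<le> \<delta> * t + inner (N y') (y - y')"
    by (simp add: \<delta>_def t_def inner_diff_left inner_diff_right norm_minus_commute)
  also have "\<dots> \<le> \<delta> * t - \<delta> / 2 * s"
    using M(2)[OF y y'] by (simp add: \<delta>_def s_def inner_diff_right)
  also have "\<dots> \<le> 32 * M * \<phi> t"
  proof (cases "2 * t \<le> s")
    case True
    then have "\<delta> * (2 * t) \<le> \<delta> * s" using nn by (intro mult_left_mono) auto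
    then have "\<delta> * t - \<delta> / 2 * s \<le> 0" by simp
    also have "0 \<le> 32 * M * \<phi> t" using M(1) phi_nonneg[OF nn(2)] by simp
    finally show ?thesis .
  next
    case False
    then have "\<delta> / (4 * M) \<le> \<omega> (2 * t)"
      using modinv_le_iff[of "\<delta> / (4 * M)" "2 * t"] nn M(1) by (simp add: s_def)
    also have "\<dots> \<le> 2 * \<omega> t" using modulus_scale[of t 2] nn by simp
    finally have "\<delta> \<le> 8 * M * \<omega> t" using M(1) by (simp add: field_simps)
    then have "\<delta> * t \<le> 8 * M * \<omega> t * t" using nn by (intro mult_right_mono) auto
    also have "\<dots> = 8 * M * (t * \<omega> t)" by simp
    also have "\<dots> \<le> 8 * M * (4 * \<phi> t)" using M(1) phi_ge[OF nn(2)] by (intro mult_left_mono) auto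
    finally have "\<delta> * t \<le> 32 * M * \<phi> t" by simp
    moreover have "0 \<le> \<delta> / 2 * s" using nn M(1) modinv_nonneg[of "\<delta> / (4 * M)"] by (simp add: s_def)
    ultimately show ?thesis by linarith
  qed
  finally show ?thesis by (simp add: t_def)
qed

lemma monotone_imp_convex_extension:
  assumes M: "0 < M" "\<And>x y. x \<in> S \<Longrightarrow> y \<in> S \<Longrightarrow>
      norm (N x - N y) / 2 * modinv \<omega> (norm (N x - N y) / (4 * M)) \<le> inner (N y) (y - x)"
  shows "\<exists>F F'. convex_on UNIV F \<and> C1w_with \<omega> F F' \<and> S = F -` {1} \<and>
      (\<forall>x\<in>S. \<forall>h. blinfun_apply (F' x) h = inner (N x) h)"
proof (cases "S = {}")
  case True
  \<comment> \<open>Without boundary, \<open>V\<close> is the whole space, and any constant other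
    than 1 serves.\<close>
  have "C1w_with \<omega> (\<lambda>_::'a. 0) (\<lambda>_. 0)"
    by (auto simp: C1w_with_def zero_blinfun.rep_eq intro!: exI[of _ 1] modulus_nonneg)
  then show ?thesis using True by (intro exI[of _ "\<lambda>_. 0"] exI[of _ "\<lambda>_. 0"]) (auto simp: convex_on_def)
next
  case False
  define C where "C = 32 * M"
  have C: "0 < C" using M(1) by (simp add: C_def)
  \<comment> \<open>\<open>r\<close> is the depth below which the tangent bowls alone need not be negative inside \<open>V\<close>;
     there the bowls \<open>h\<close> centred at deep points take over. The factor 64 in \<open>h\<close> makes
     \<open>h z\<close> dominate the 1-Lipschitz supporting functionals.\<close>
  define r where "r = modinv \<omega> (1 / (16 * C))"
  have r: "0 < r" "\<omega> r = 1 / (16 * C)" using modinv_pos modulus_modinv C by (auto simp: r_def)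
  define a where "a y x = inner (N y) (x - y) + C * \<phi> (norm (x - y))" for x y
  define h where "h z x = - r + 64 * C * \<phi> (norm (x - z))" for x z :: 'a
  define \<Psi> where "\<Psi> = a ` S \<union> h ` {z. ball z (2 * r) \<subseteq> V}"
  define supp where "supp y x = inner (N y) (x - y)" for x y
  have supp_convex: "convex_on UNIV (supp y)" for y
    by (rule convex_onI) (simp_all add: supp_def inner_diff_right inner_add_right algebra_simps)
  have supp_le: "supp y x \<le> \<psi> x" if y: "y \<in> S" and \<psi>: "\<psi> \<in> \<Psi>" for y x \<psi>
  proof -
    consider y' where "y' \<in> S" "\<psi> = a y'" | z where "ball z (2 * r) \<subseteq> V" "\<psi> = h z"
      using \<psi> by (auto simp: \<Psi>_def)
    then show ?thesis
    proof cases
      case 1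
      then show ?thesis using monotone_imp_tangent_bowl[OF M, of y' y x] y
        by (simp add: supp_def a_def C_def)
    next
      case 2
      define t where "t = norm (x - z)"
      have t0: "0 \<le> t" by (simp add: t_def)
      have "supp y x = inner (N y) (z - y) + inner (N y) (x - z)"
        by (simp add: supp_def inner_diff_right)
      also have "\<dots> \<le> - (2 * r) + norm (N y) * norm (x - z)"
        using N_le_ball[OF y 2(1)] r by (intro add_mono norm_cauchy_schwarz) auto
      finally have "supp y x \<le> - (2 * r) + t" using norm_N[OF y] by (simp add: t_def)
      \<comment> \<open>Beyond \<open>r\<close> the identity \<open>16 * C * \<omega> r = 1\<close>
        makes the bowl grow at least as fast as \<open>t\<close>; the factor 4 from
        \<open>phi_ge\<close> yields 64.\<close>
      moreover have "t \<le> r + 64 * C * \<phi> t"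
      proof (cases "t \<le> r")
        case True
        then show ?thesis using phi_nonneg[OF t0] C by (simp add: add_increasing2)
      next
        case f: False
        have "t = 16 * C * (t * \<omega> r)" using r C by simp
        also have "\<dots> \<le> 16 * C * (t * \<omega> t)" using f C t0 r by (intro mult_left_mono modulus_mono) auto
        also have "\<dots> \<le> 16 * C * (4 * \<phi> t)" using C phi_ge[OF t0] by (intro mult_left_mono) auto
        finally show ?thesis using r by simp
      qed
      ultimately show ?thesis using 2 by (simp add: h_def t_def)
    qed
  qed
  \<comment> \<open>384 is 6, from \<open>bowl_second_difference\<close>, times 64, the larger of
    the two bowl coefficients; linear parts have zero second difference.\<close>
  define \<sigma> where "\<sigma> u = 384 * C * (norm u * \<omega> (norm u))" for u :: 'a
  have bowl: "k * \<phi> (norm (x + u - y)) + k * \<phi> (norm (x - u - y)) - 2 * (k * \<phi> (norm (x - y))) \<le> \<sigma> u"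
    if k: "0 \<le> k" "k \<le> 64 * C" for k x u y
  proof -
    have "k * (\<phi> (norm (x - y + u)) + \<phi> (norm (x - y - u)) - 2 * \<phi> (norm (x - y)))
        \<le> k * (6 * (norm u * \<omega> (norm u)))"
      using k by (intro mult_left_mono bowl_second_difference) auto
    also have "\<dots> \<le> 64 * C * (6 * (norm u * \<omega> (norm u)))"
      using k by (intro mult_right_mono) (simp_all add: modulus_nonneg)
    finally show ?thesis by (simp add: \<sigma>_def algebra_simps)
  qed
  have sd: "\<psi> (x + u) + \<psi> (x - u) - 2 * \<psi> x \<le> \<sigma> u" if \<psi>: "\<psi> \<in> \<Psi>" for \<psi> x u
  proof -
    consider y where "\<psi> = a y" | z where "\<psi> = h z" using \<psi> by (auto simp: \<Psi>_def)
    then show ?thesis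
    proof cases
      case 1
      have "a y (x + u) + a y (x - u) - 2 * a y x
          = C * \<phi> (norm (x + u - y)) + C * \<phi> (norm (x - u - y)) - 2 * (C * \<phi> (norm (x - y)))"
        by (simp add: a_def inner_diff_right inner_add_right)
      then show ?thesis using bowl[of C x u y] C unfolding 1 by linarith
    next
      case 2
      have "h z (x + u) + h z (x - u) - 2 * h z x = 64 * C * \<phi> (norm (x + u - z))
          + 64 * C * \<phi> (norm (x - u - z)) - 2 * (64 * C * \<phi> (norm (x - z)))"
        by (simp add: h_def)
      then show ?thesis using bowl[of "64 * C" x u z] C unfolding 2 by linarith
    qed
  qed
  obtain y0 where y0: "y0 \<in> S" using False by auto
  have "\<exists>f. convex_on UNIV f \<and> (\<forall>\<psi>\<in>\<Psi>. \<forall>x. f x \<le> \<psi> x) \<and>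
    (\<forall>h. convex_on UNIV h \<and> (\<forall>\<psi>\<in>\<Psi>. \<forall>x. h x \<le> \<psi> x) \<longrightarrow> (\<forall>x. h x \<le> f x)) \<and>
    (\<forall>x u. f (x + u) + f (x - u) - 2 * f x \<le> \<sigma> u)"
  proof (rule convex_envelope_exists[of \<Psi> "supp y0" \<sigma>])
    show "\<Psi> \<noteq> {}" using y0 by (auto simp: \<Psi>_def)
    show "convex_on UNIV (supp y0)" by (rule supp_convex)
    show "supp y0 x \<le> \<psi> x" if "\<psi> \<in> \<Psi>" for \<psi> x by (rule supp_le[OF y0 that])
    show "\<psi> (x + u) + \<psi> (x - u) - 2 * \<psi> x \<le> \<sigma> u" if "\<psi> \<in> \<Psi>" for \<psi> x u
      by (rule sd[OF that])
  qed
  then obtain f where f: "convex_on UNIV f" "\<And>\<psi> x. \<psi> \<in> \<Psi> \<Longrightarrow> f x \<le> \<psi> x"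
    "\<And>h x. convex_on UNIV h \<Longrightarrow> (\<forall>\<psi>\<in>\<Psi>. \<forall>x. h x \<le> \<psi> x) \<Longrightarrow> h x \<le> f x"
    "\<And>x u. f (x + u) + f (x - u) - 2 * f x \<le> \<sigma> u"
    by (elim exE conjE) blast
  \<comment> \<open>Supporting functionals are themselves convex minorants of \<open>\<Psi>\<close>.
    On \<open>S\<close> they meet the tangent bowls, which pins \<open>f\<close> to 0 there.\<close>
  have f_ge: "supp y x \<le> f x" if "y \<in> S" for x y
    using supp_convex supp_le[OF that] by (intro f(3)) auto
  have f_le: "f x \<le> a y x" if "y \<in> S" for x y
    using f(2)[of "a y" x] that by (simp add: \<Psi>_def)
  have f_zero: "f x = 0" if "x \<in> S" for x
    using f_ge[OF that, of x] f_le[OF that, of x] by (simp add: supp_def a_def)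
  have f_pos: "0 < f p" if p: "p \<notin> V" for p
  proof -
    obtain z where z: "z \<in> interior V" using interior_nonempty by auto
    have "p \<notin> interior V" using p interior_subset by auto
    then obtain y where "y \<in> S" "0 < inner (N y) (p - y)"
      using crossing_point[OF z, of p] p by blast
    then show ?thesis using f_ge[of y p] by (simp add: supp_def)
  qed
  \<comment> \<open>Deep points are covered by their own bowl, of depth \<open>r\<close>. For the
    others, the linear part of a nearby tangent bowl is at most \<open>- d\<close>, while its curved
    part is at most \<open>d / 2\<close>.\<close>
  have f_neg: "f z < 0" if z: "z \<in> interior V" for z
  proof -
    define d where "d = infdist z S"
    have zS: "z \<notin> S" using z by (simp add: frontier_def)
    have d: "0 < d" using zS False infdist_pos_not_in_closed[of S z] by (simp add: d_def)
    have "d \<le> dist z y" if "y \<in> S" for y using infdist_le[OF that] by (simp add: d_def)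
    then have disj: "ball z d \<inter> S = {}" by (auto simp: not_less[symmetric])
    have ball: "ball z d \<subseteq> V"
    proof (rule ccontr)
      assume "\<not> ?thesis"
      moreover have "z \<in> ball z d \<inter> V" using d z interior_subset by auto
      ultimately have "ball z d \<inter> S \<noteq> {}" by (intro connected_Int_frontier connected_ball) blast+
      then show False using disj by simp
    qed
    show ?thesis
    proof (cases "2 * r \<le> d")
      case True
      then have "ball z (2 * r) \<subseteq> V" using ball subset_ball[of "2 * r" d z] by blast
      then have "h z \<in> \<Psi>" by (simp add: \<Psi>_def)
      then have "f z \<le> h z z" by (rule f(2))
      then show ?thesis using r by (simp add: h_def)
    next
      case c: False
      \<comment> \<open>The distance to \<open>S\<close> need not be attained, so a boundary point
        within \<open>2 * d\<close> is taken instead of a nearest one.\<close>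
      have "\<not> (\<forall>y\<in>S. 2 * d \<le> dist z y)"
        using cINF_greatest[of S "2 * d" "dist z"] infdist_notempty[of S z] False d by (auto simp: d_def)
      then obtain y where y: "y \<in> S" "dist z y < 2 * d" by auto
      have "\<phi> (norm (z - y)) \<le> \<phi> (2 * d)" using y by (intro phi_mono) (auto simp: dist_norm)
      also have "\<dots> \<le> 2 * d * \<omega> (2 * d)" using phi_le[of "2 * d"] d by simp
      also have "\<dots> \<le> 2 * d * (4 * \<omega> r)"
        using modulus_mono[of "2 * d" "4 * r"] modulus_scale[of r 4] c d r(1) by (intro mult_left_mono) auto
      finally have "C * \<phi> (norm (z - y)) \<le> C * (2 * d * (4 * \<omega> r))" using C by (intro mult_left_mono) auto
      also have "\<dots> = d / 2" using r C by simp
      finally show ?thesis using f_le[OF y(1), of z] N_le_ball[OF y(1) ball d] d by (simp add: a_def)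
    qed
  qed
  have level: "S = {x. f x = 0}"
  proof -
    have "x \<in> S" if "f x = 0" for x
      using that f_pos[of x] f_neg[of x] closed_V by (auto simp: frontier_def)
    then show ?thesis using f_zero by auto
  qed
  have up: "\<exists>B. \<forall>u. norm u \<le> 1 \<longrightarrow> f (x + u) \<le> B" for x
  proof (intro exI allI impI)
    fix u :: 'a assume u: "norm u \<le> 1"
    define n where "n = norm (x - y0) + 1"
    have n: "norm (x + u - y0) \<le> n"
      using u norm_triangle_ineq[of "x - y0" u] by (simp add: n_def algebra_simps)
    have "f (x + u) \<le> inner (N y0) (x + u - y0) + C * \<phi> (norm (x + u - y0))"
      using f_le[OF y0, of "x + u"] by (simp add: a_def)
    also have "\<dots> \<le> norm (N y0) * norm (x + u - y0) + C * \<phi> n"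
      using n C by (intro add_mono norm_cauchy_schwarz mult_left_mono phi_mono) auto
    also have "\<dots> \<le> n + C * \<phi> n" using n norm_N[OF y0] by simp
    finally show "f (x + u) \<le> norm (x - y0) + 1 + C * \<phi> (norm (x - y0) + 1)" by (simp add: n_def)
  qed
  define F where "F x = 1 + f x" for x
  have "convex_on UNIV F" unfolding F_def using f(1) by (intro convex_on_add) (auto simp: convex_on_const)
  moreover have "\<exists>F'. C1w_with \<omega> F F'"
  proof (rule C1w_of_convex_second_difference)
    show "convex_on UNIV F" by fact
    show "0 < 384 * C" using C by simp
    show "F (x + u) + F (x - u) - 2 * F x \<le> 384 * C * (norm u * \<omega> (norm u))" for x u
      using f(4)[of x u] by (simp add: F_def \<sigma>_def)
    fix x
    obtain B where "\<forall>u. norm u \<le> 1 \<longrightarrow> f (x + u) \<le> B" using up by blast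
    then show "\<exists>B. \<forall>u. norm u \<le> 1 \<longrightarrow> F (x + u) \<le> B" by (intro exI[of _ "1 + B"]) (simp add: F_def)
  qed
  then obtain F' where F': "C1w_with \<omega> F F'" by blast
  moreover have "S = F -` {1}" unfolding level by (simp add: F_def vimage_def)
  moreover have "blinfun_apply (F' x) k = inner (N x) k" if x: "x \<in> S" for x k
  proof -
    \<comment> \<open>\<open>F\<close> minus its supporting functional has a global minimum at
      \<open>x\<close>, so its derivative vanishes there.\<close>
    have "((\<lambda>y. F y - inner (N x) (y - x)) has_derivative (\<lambda>k. blinfun_apply (F' x) k - inner (N x) k)) (at x)"
    proof (rule has_derivative_diff)
      show "(F has_derivative blinfun_apply (F' x)) (at x)" using F' by (simp add: C1w_with_def)
      show "((\<lambda>y. inner (N x) (y - x)) has_derivative inner (N x)) (at x)"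
        by (auto intro!: derivative_eq_intros)
    qed
    moreover have "F x - inner (N x) (x - x) \<le> F y - inner (N x) (y - x)" for y
      using f_ge[OF x, of y] f_zero[OF x] by (simp add: F_def supp_def)
    ultimately have "(\<lambda>k. blinfun_apply (F' x) k - inner (N x) k) = (\<lambda>_. 0)"
      by (intro differential_zero_maxmin[where S = UNIV]) auto
    then have "blinfun_apply (F' x) k - inner (N x) k = 0" by (rule fun_cong)
    then show ?thesis by simp
  qed
  ultimately show ?thesis by blast
qed

end

section \<open>Return from (5) to (1)\<close>

context smooth_convex_body
begin

text \<open>Shared by (5) and (6): derivatives that are positive multiples of the normals control
  the normals, with the length \<open>a\<close> as the only loss.\<close>

lemma normal_diff_le_derivative_diff:
  assumes "x \<in> S" "y \<in> S" "0 < a" "0 < b"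
    and D: "\<And>h. blinfun_apply D h = a * inner (N x) h" and E: "\<And>h. blinfun_apply E h = b * inner (N y) h"
  shows "a * norm (N x - N y) \<le> 2 * norm (D - E)"
proof -
  have "norm (a *\<^sub>R N x - b *\<^sub>R N y) \<le> norm (D - E)"
    by (rule norm_riesz_le) (simp add: blinfun.diff_left D E inner_diff_left)
  then show ?thesis using norm_unit_diff_le[of "N x" "N y" a b] norm_N assms by simp
qed

text \<open>The connected set \<open>interior V\<close> misses the level 1, which is only attained
  on the boundary, so \<open>F - 1\<close> has one sign there; density of the interior carries it to
  \<open>V\<close>.\<close>

lemma level_set_sign:
  assumes F: "continuous_on UNIV F" and S: "S = F -` {1::real}"
  shows "(\<forall>y\<in>V. F y \<le> 1) \<or> (\<forall>y\<in>V. F y \<ge> 1)"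
proof -
  have c: "connected (F ` interior V)"
    using convex_V F by (intro connected_continuous_image convex_connected convex_interior)
      (auto intro: continuous_on_subset)
  have n1: "1 \<notin> F ` interior V"
  proof
    assume "1 \<in> F ` interior V"
    then obtain z where "z \<in> interior V" "z \<in> S" unfolding S by auto
    then show False by (simp add: frontier_def)
  qed
  have sgn: "(\<forall>z\<in>interior V. F z \<le> 1) \<or> (\<forall>z\<in>interior V. F z \<ge> 1)"
  proof (rule ccontr)
    assume "\<not> ?thesis"
    then obtain u v where "u \<in> interior V" "1 < F u" "v \<in> interior V" "F v < 1" by (auto simp: not_le)
    then have "1 \<in> F ` interior V" using connectedD_interval[OF c, of "F v" "F u" 1] by auto
    then show False using n1 by simp
  qed
  have cl: "V \<subseteq> closure (interior V)"
    using interior_approx by (force simp: closure_approachable dist_norm)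
  have "closed {y. F y \<le> 1}" "closed {y. 1 \<le> F y}"
    using F by (auto intro!: closed_Collect_le continuous_intros)
  then have "interior V \<subseteq> {y. F y \<le> 1} \<Longrightarrow> V \<subseteq> {y. F y \<le> 1}"
    "interior V \<subseteq> {y. 1 \<le> F y} \<Longrightarrow> V \<subseteq> {y. 1 \<le> F y}"
    using cl closure_minimal by blast+
  then show ?thesis using sgn by blast
qed

lemma convex_hypersurface_imp_normal_modulus:
  assumes "convex_hypersurface_C1w \<omega> S"
  shows "\<exists>M>0. \<forall>x\<in>S. \<forall>y\<in>S. norm (N x - N y) \<le> M * \<omega> (norm (x - y))"
proof -
  obtain M F F' where M: "0 < M" and F: "C1w_with \<omega> F F'" and S: "S = F -` {1}"
    and bd: "\<And>x. x \<in> S \<Longrightarrow> 1 / M \<le> norm (F' x)"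
    using assms unfolding convex_hypersurface_C1w_def by blast
  obtain K where K: "0 < K" "\<And>x y. norm (F' x - F' y) \<le> K * \<omega> (norm (x - y))"
    and der: "\<And>x. (F has_derivative blinfun_apply (F' x)) (at x)"
    using F unfolding C1w_with_def by blast
  have cont: "continuous_on UNIV F"
    using der by (meson continuous_at_imp_continuous_on has_derivative_continuous)
  \<comment> \<open>If \<open>V\<close> is a half-space, \<open>F\<close> may exceed 1 inside \<open>V\<close>; the sign \<open>\<sigma>\<close> covers this case.\<close>
  obtain \<sigma> :: real where \<sigma>: "\<sigma> = 1 \<or> \<sigma> = -1" and le: "\<And>y. y \<in> V \<Longrightarrow> \<sigma> * F y \<le> \<sigma> * 1"
    using level_set_sign[OF cont S] that[of 1] that[of "-1"] by auto
  have rep: "\<exists>c>0. 1 / M \<le> c \<and> (\<forall>h. blinfun_apply (\<sigma> *\<^sub>R F' x) h = c * inner (N x) h)" if x: "x \<in> S" for x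
  proof -
    have "F x = 1" using S x by auto
    have "((\<lambda>y. \<sigma> * F y) has_derivative (\<lambda>h. \<sigma> * blinfun_apply (F' x) h)) (at x)"
      using der by (rule has_derivative_mult_right)
    then have "\<sigma> * blinfun_apply (F' x) (y - x) \<le> 0" if "y \<in> V" for y
      using has_derivative_nonpos_direction[OF _ convex_V S_subset[OF x] that, of "\<lambda>y. \<sigma> * F y"] le
        \<open>F x = 1\<close> by simp
    moreover have "bounded_linear (\<lambda>h. \<sigma> * blinfun_apply (F' x) h)"
      by (intro bounded_linear_const_mult blinfun.bounded_linear_right)
    ultimately obtain c where c: "0 \<le> c" "\<And>h. \<sigma> * blinfun_apply (F' x) h = c * inner (N x) h"
      using normal_functional_unique[OF x, of "\<lambda>h. \<sigma> * blinfun_apply (F' x) h"] by blast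
    \<comment> \<open>As \<open>N x\<close> is a unit vector, the derivative has norm at most
      \<open>c\<close>, so its lower bound \<open>1 / M\<close> passes to \<open>c\<close>.\<close>
    have "norm (\<sigma> *\<^sub>R F' x) \<le> c"
    proof (rule norm_blinfun_bound[OF c(1)])
      fix h
      have "\<bar>inner (N x) h\<bar> \<le> norm h" using Cauchy_Schwarz_ineq2[of "N x" h] norm_N[OF x] by simp
      then show "norm (blinfun_apply (\<sigma> *\<^sub>R F' x) h) \<le> c * norm h"
        using c by (simp add: blinfun.scaleR_left abs_mult mult_left_mono)
    qed
    then have "1 / M \<le> c" using bd[OF x] \<sigma> by auto
    moreover have "0 < 1 / M" using M by simp
    then have "0 < c" using \<open>1 / M \<le> c\<close> by linarith
    ultimately show ?thesis using c by (intro exI[of _ c]) (auto simp: blinfun.scaleR_left)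
  qed
  have "norm (N x - N y) \<le> (2 * M * K) * \<omega> (norm (x - y))" if x: "x \<in> S" and y: "y \<in> S" for x y
  proof -
    obtain a where a: "0 < a" "1 / M \<le> a" "\<And>h. blinfun_apply (\<sigma> *\<^sub>R F' x) h = a * inner (N x) h"
      using rep[OF x] by blast
    obtain b where b: "0 < b" "\<And>h. blinfun_apply (\<sigma> *\<^sub>R F' y) h = b * inner (N y) h"
      using rep[OF y] by blast
    have "1 / M * norm (N x - N y) \<le> a * norm (N x - N y)" using a by (intro mult_right_mono) auto
    also have "\<dots> \<le> 2 * norm (\<sigma> *\<^sub>R F' x - \<sigma> *\<^sub>R F' y)"
      by (rule normal_diff_le_derivative_diff[OF x y a(1) b(1) a(3) b(2)])
    also have "\<dots> = 2 * norm (F' x - F' y)" using \<sigma> by (auto simp: norm_minus_commute)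
    also have "\<dots> \<le> 2 * (K * \<omega> (norm (x - y)))" using K(2) by simp
    finally show ?thesis using M by (simp add: field_simps)
  qed
  then show ?thesis using M K(1) by (intro exI[of _ "2 * M * K"]) auto
qed

end

section \<open>The Minkowski functional of a bounded body\<close>

locale bounded_smooth_convex_body = smooth_convex_body +
  fixes r R :: real
  assumes r: "0 < r" "ball 0 r \<subseteq> V" and R: "0 < R" "\<And>x. x \<in> V \<Longrightarrow> norm x \<le> R"
begin

abbreviation \<mu> :: "'a \<Rightarrow> real" where "\<mu> \<equiv> minkowski_functional V"

lemma zero_in: "0 \<in> V" using r by auto

lemma bdd_scalings: "bdd_below {t. t > 0 \<and> x /\<^sub>R t \<in> V}"
  by (rule bdd_belowI[of _ 0]) auto

lemma scaling_exists: "\<exists>t. t > 0 \<and> x /\<^sub>R t \<in> V"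
proof -
  define t where "t = (norm x + 1) / r"
  have n: "0 < norm x + 1" by (intro add_nonneg_pos) auto
  then have t: "0 < t" using r by (simp add: t_def)
  have "norm (x /\<^sub>R t) < r"
    using t r n by (simp add: t_def field_simps)
  then show ?thesis using t r by (intro exI[of _ t]) auto
qed

lemma minkowski_le: "t > 0 \<Longrightarrow> x /\<^sub>R t \<in> V \<Longrightarrow> \<mu> x \<le> t"
  unfolding minkowski_functional_def by (intro cInf_lower bdd_scalings) auto

lemma minkowski_ge: "(\<And>t. t > 0 \<Longrightarrow> x /\<^sub>R t \<in> V \<Longrightarrow> b \<le> t) \<Longrightarrow> b \<le> \<mu> x"
  unfolding minkowski_functional_def using scaling_exists[of x] by (intro cInf_greatest) auto

lemma minkowski_zero: "\<mu> 0 = 0"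
proof (rule antisym)
  have "\<mu> 0 \<le> 0 + e" if "0 < e" for e using minkowski_le[OF that, of 0] zero_in by simp
  then show "\<mu> 0 \<le> 0" by (rule field_le_epsilon)
qed (auto intro: minkowski_ge)

text \<open>Boundedness enters here: \<open>V\<close> inside the ball of radius \<open>R\<close>
  gives \<open>norm x / R \<le> \<mu> x\<close>.\<close>

lemma minkowski_pos: "0 < \<mu> x" if "x \<noteq> 0"
proof -
  have "norm x / R \<le> \<mu> x"
  proof (rule minkowski_ge)
    fix t assume "t > 0" "x /\<^sub>R t \<in> V"
    then have "norm x / t \<le> R" using R(2)[of "x /\<^sub>R t"] by (simp add: divide_inverse mult.commute)
    then show "norm x / R \<le> t" using \<open>t > 0\<close> R(1) by (simp add: field_simps)
  qed
  then show ?thesis using that R(1) by (smt (verit) divide_pos_pos zero_less_norm_iff)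
qed

lemma scaling_in: "x /\<^sub>R t \<in> V" if xt: "\<mu> x < t"
proof -
  obtain s where s: "0 < s" "x /\<^sub>R s \<in> V" "s < t"
    using xt minkowski_ge[of x t] by (meson not_le)
  have "(1 - s / t) *\<^sub>R 0 + (s / t) *\<^sub>R (x /\<^sub>R s) \<in> V"
    using s convex_V zero_in by (intro convexD_alt) auto
  moreover have "(1 - s / t) *\<^sub>R 0 + (s / t) *\<^sub>R (x /\<^sub>R s) = x /\<^sub>R t" using s by (simp add: field_simps)
  ultimately show ?thesis by metis
qed

text \<open>The radial projection onto \<open>S\<close>, meaningful for
  \<open>x \<noteq> 0\<close>.\<close>

definition boundary_point :: "'a \<Rightarrow> 'a" where "boundary_point x = x /\<^sub>R \<mu> x"

text \<open>Closedness puts the limit of the admissible scalings in \<open>V\<close>. If it were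
  interior, it could be stretched by \<open>1 + k\<close> inside \<open>V\<close>, giving a scaling
  factor below the infimum.\<close>

lemma boundary_point_in: "boundary_point x \<in> S" if x: "x \<noteq> 0"
proof -
  have \<mu>: "0 < \<mu> x" by (rule minkowski_pos[OF x])
  have "boundary_point x \<in> V"
  proof (rule closed_sequentially[OF closed_V])
    show "\<And>n. x /\<^sub>R (\<mu> x + inverse (real (Suc n))) \<in> V" by (rule scaling_in) simp
    show "(\<lambda>n. x /\<^sub>R (\<mu> x + inverse (real (Suc n)))) \<longlonglongrightarrow> boundary_point x"
      unfolding boundary_point_def using \<mu>
      by (intro tendsto_scaleR tendsto_inverse LIMSEQ_inverse_real_of_nat_add tendsto_const) simp
  qed
  moreover have "boundary_point x \<notin> interior V"
  proof
    assume "boundary_point x \<in> interior V"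
    then obtain e where e: "0 < e" "ball (boundary_point x) e \<subseteq> V" by (auto simp: mem_interior)
    define k where "k = e / (2 * norm (boundary_point x))"
    have bp: "0 < norm (boundary_point x)" using x \<mu> by (simp add: boundary_point_def)
    have k: "0 < k" using e bp by (simp add: k_def)
    have "boundary_point x + k *\<^sub>R boundary_point x \<in> ball (boundary_point x) e"
      using e bp by (simp add: dist_norm k_def)
    then have "boundary_point x + k *\<^sub>R boundary_point x \<in> V" using e by blast
    moreover have "boundary_point x + k *\<^sub>R boundary_point x = x /\<^sub>R (\<mu> x / (1 + k))"
      using k by (simp add: boundary_point_def algebra_simps divide_inverse)
    ultimately have "\<mu> x \<le> \<mu> x / (1 + k)" using \<mu> k by (intro minkowski_le) auto
    then have "k * \<mu> x \<le> 0" using k by (simp add: field_simps)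
    then show False using mult_pos_pos[OF k \<mu>] by simp
  qed
  ultimately show ?thesis using closed_V by (simp add: frontier_def)
qed

lemma support_ge: "r \<le> inner (N s) s" if "s \<in> S"
  using N_le_ball[OF that r(2,1)] by simp

lemma support_le: "inner (N s) s \<le> R" if "s \<in> S"
  using norm_cauchy_schwarz[of "N s" s] norm_N[OF that] R(2)[OF S_subset[OF that]] by simp

text \<open>The supporting functional at \<open>s\<close>, normalised to 1 at \<open>s\<close>, is
  at most 1 on \<open>V\<close>, hence at most \<open>\<mu>\<close> everywhere by
  homogeneity.\<close>

lemma minkowski_ge_support: "inner (N s) y / inner (N s) s \<le> \<mu> y" if s: "s \<in> S"
proof (rule minkowski_ge)
  fix t assume t: "0 < t" "y /\<^sub>R t \<in> V"
  have "inner (N s) y / t \<le> inner (N s) s"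
    using N_le[OF s t(2)] by (simp add: inner_diff_right divide_inverse mult.commute)
  then show "inner (N s) y / inner (N s) s \<le> t" using t support_ge[OF s] r(1) by (simp add: field_simps)
qed

lemma minkowski_boundary: "\<mu> s = 1" if s: "s \<in> S"
proof (rule antisym)
  show "\<mu> s \<le> 1" using minkowski_le[of 1 s] S_subset[OF s] by simp
  show "1 \<le> \<mu> s" using minkowski_ge_support[OF s, of s] support_ge[OF s] r(1) by simp
qed

text \<open>\<open>\<mu>\<close> minus the normalised supporting functional is minimal at
  \<open>s\<close>, which identifies the derivative of \<open>\<mu>\<close> on \<open>S\<close>. Its
  length is at least \<open>1 / R\<close>, whence the factor \<open>2 * R\<close>.\<close>

lemma minkowski_smooth_imp_normal_modulus:
  assumes der: "\<And>x. 1 \<le> \<mu> x \<Longrightarrow> (\<mu> has_derivative blinfun_apply (G x)) (at x)"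
    and K: "0 < K" "\<And>x y. 1 \<le> \<mu> x \<Longrightarrow> 1 \<le> \<mu> y \<Longrightarrow> norm (G x - G y) \<le> K * \<omega> (norm (x - y))"
    and x: "x \<in> S" and y: "y \<in> S"
  shows "norm (N x - N y) \<le> 2 * R * K * \<omega> (norm (x - y))"
proof -
  have G: "blinfun_apply (G s) h = 1 / inner (N s) s * inner (N s) h" if s: "s \<in> S" for s h
  proof -
    define c where "c = 1 / inner (N s) s"
    have cs: "c * inner (N s) s = 1" using support_ge[OF s] r(1) by (simp add: c_def)
    have "((\<lambda>y. \<mu> y - c * inner (N s) y) has_derivative (\<lambda>h. blinfun_apply (G s) h - c * inner (N s) h)) (at s)"
    proof (rule has_derivative_diff)
      show "(\<mu> has_derivative blinfun_apply (G s)) (at s)" using minkowski_boundary[OF s] der by simp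
      show "((\<lambda>y. c * inner (N s) y) has_derivative (\<lambda>h. c * inner (N s) h)) (at s)"
        by (auto intro!: derivative_eq_intros)
    qed
    moreover have "\<mu> s - c * inner (N s) s \<le> \<mu> y - c * inner (N s) y" for y
      using minkowski_ge_support[OF s, of y] minkowski_boundary[OF s] cs by (simp add: c_def)
    ultimately have "(\<lambda>h. blinfun_apply (G s) h - c * inner (N s) h) = (\<lambda>_. 0)"
      by (intro differential_zero_maxmin[where S = UNIV]) auto
    then have "blinfun_apply (G s) h - c * inner (N s) h = 0" by (rule fun_cong)
    then show ?thesis by (simp add: c_def)
  qed
  have pos: "0 < 1 / inner (N s) s" if "s \<in> S" for s using support_ge[OF that] r(1) by simp
  have "1 / R \<le> 1 / inner (N x) x" using support_le[OF x] support_ge[OF x] r(1) by (simp add: frac_le)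
  then have "1 / R * norm (N x - N y) \<le> 1 / inner (N x) x * norm (N x - N y)"
    by (intro mult_right_mono) auto
  also have "\<dots> \<le> 2 * norm (G x - G y)"
    by (rule normal_diff_le_derivative_diff[OF x y pos[OF x] pos[OF y] G[OF x] G[OF y]])
  also have "\<dots> \<le> 2 * (K * \<omega> (norm (x - y)))" using K(2) minkowski_boundary x y by simp
  finally show ?thesis using R(1) by (simp add: field_simps)
qed

definition grad :: "'a \<Rightarrow> 'a" where
  "grad x = N (boundary_point x) /\<^sub>R inner (N (boundary_point x)) (boundary_point x)"

lemma grad_subgradient: "inner (grad x) (y - x) \<le> \<mu> y - \<mu> x" if x: "x \<noteq> 0"
proof -
  define s where "s = boundary_point x"
  have s: "s \<in> S" using boundary_point_in[OF x] by (simp add: s_def)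
  have ss: "0 < inner (N s) s" using support_ge[OF s] r(1) by simp
  have "x = \<mu> x *\<^sub>R s" using minkowski_pos[OF x] by (simp add: s_def boundary_point_def)
  then have "inner (N s) x = \<mu> x * inner (N s) s" by (metis inner_scaleR_right)
  then have "inner (grad x) x = \<mu> x" using ss by (simp add: grad_def s_def[symmetric])
  moreover have "inner (grad x) y \<le> \<mu> y"
    using minkowski_ge_support[OF s, of y] by (simp add: grad_def s_def[symmetric] divide_inverse mult.commute)
  ultimately show ?thesis by (simp add: inner_diff_right)
qed

lemma norm_grad: "norm (grad x) \<le> 1 / r" if x: "x \<noteq> 0"
proof -
  define s where "s = boundary_point x"
  have s: "s \<in> S" using boundary_point_in[OF x] by (simp add: s_def)
  have "norm (grad x) = 1 / inner (N s) s"
    using norm_N[OF s] support_ge[OF s] r(1) by (simp add: grad_def s_def[symmetric] divide_inverse)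
  also have "\<dots> \<le> 1 / r" using support_ge[OF s] r(1) by (simp add: frac_le)
  finally show ?thesis .
qed

lemma minkowski_lipschitz: "\<bar>\<mu> x - \<mu> y\<bar> \<le> norm (x - y) / r" if "x \<noteq> 0" "y \<noteq> 0"
proof -
  have *: "\<mu> x - \<mu> y \<le> norm (x - y) / r" if "x \<noteq> 0" for x y
  proof -
    have "\<mu> x - \<mu> y \<le> inner (grad x) (x - y)"
      using grad_subgradient[OF that, of y] by (simp add: inner_diff_right)
    also have "\<dots> \<le> norm (grad x) * norm (x - y)" by (rule norm_cauchy_schwarz)
    also have "\<dots> \<le> 1 / r * norm (x - y)" using norm_grad[OF that] by (intro mult_right_mono) auto
    finally show ?thesis by simp
  qed
  show ?thesis using *[OF that(1), of y] *[OF that(2), of x] by (simp add: abs_le_iff norm_minus_commute)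
qed

text \<open>The difference splits into a displacement divided by \<open>\<mu> x\<close> and a change
  of scale, the latter controlled by the \<open>1 / r\<close> Lipschitz bound on
  \<open>\<mu>\<close> and the radius \<open>R\<close>.\<close>

lemma boundary_point_lipschitz:
  assumes "0 < \<beta>" "\<beta> \<le> \<mu> x" "\<beta> \<le> \<mu> y"
  shows "norm (boundary_point x - boundary_point y) \<le> (1 + R / r) / \<beta> * norm (x - y)"
proof -
  have nz: "x \<noteq> 0" "y \<noteq> 0" using assms minkowski_zero by auto
  have \<mu>: "0 < \<mu> x" "0 < \<mu> y" using assms by auto
  have "boundary_point x - boundary_point y
      = (1 / \<mu> x) *\<^sub>R ((x - y) + (\<mu> y - \<mu> x) *\<^sub>R boundary_point y)"
    using \<mu> by (simp add: boundary_point_def algebra_simps divide_inverse)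
  also have "norm \<dots> = 1 / \<mu> x * norm ((x - y) + (\<mu> y - \<mu> x) *\<^sub>R boundary_point y)" using \<mu> by simp
  also have "\<dots> \<le> 1 / \<beta> * (norm (x - y) + norm (x - y) / r * R)"
  proof (intro mult_mono)
    show "1 / \<mu> x \<le> 1 / \<beta>" using assms by (simp add: frac_le)
    have "norm ((x - y) + (\<mu> y - \<mu> x) *\<^sub>R boundary_point y)
        \<le> norm (x - y) + \<bar>\<mu> y - \<mu> x\<bar> * norm (boundary_point y)"
      using norm_triangle_ineq[of "x - y" "(\<mu> y - \<mu> x) *\<^sub>R boundary_point y"] by simp
    also have "\<dots> \<le> norm (x - y) + norm (x - y) / r * R"
      using minkowski_lipschitz[OF nz(2,1)] R(2)[OF S_subset[OF boundary_point_in[OF nz(2)]]] r(1)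
      by (intro add_left_mono mult_mono) (auto simp: norm_minus_commute)
    finally show "norm ((x - y) + (\<mu> y - \<mu> x) *\<^sub>R boundary_point y) \<le> norm (x - y) + norm (x - y) / r * R" .
  qed (use assms in auto)
  also have "\<dots> = (1 + R / r) / \<beta> * norm (x - y)" by (simp add: field_simps)
  finally show ?thesis .
qed

lemma grad_modulus:
  assumes M: "0 < M" "\<And>x y. x \<in> S \<Longrightarrow> y \<in> S \<Longrightarrow> norm (N x - N y) \<le> M * \<omega> (norm (x - y))"
    and \<beta>: "0 < \<beta>"
  shows "\<exists>K>0. \<forall>x y. \<beta> \<le> \<mu> x \<longrightarrow> \<beta> \<le> \<mu> y \<longrightarrow> norm (grad x - grad y) \<le> K * \<omega> (norm (x - y))"
proof -
  \<comment> \<open>The Lipschitz constant of the radial projection, raised to at least 1 so that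
    \<open>modulus_scale\<close> can pull it out of \<open>\<omega>\<close>.\<close>
  define L where "L = max 1 ((1 + R / r) / \<beta>)"
  \<comment> \<open>On a set of diameter at most \<open>2 * R\<close>, \<open>modulus_star\<close>
    gives \<open>d \<le> c * \<omega> d\<close>, so Lipschitz terms are absorbed into the
    modulus.\<close>
  define c where "c = 2 * R / \<omega> (2 * R)"
  define k where "k = M / r + (M * R + c) / r\<^sup>2"
  have wR: "0 < \<omega> (2 * R)" using modulus_pos R(1) by simp
  have c: "0 < c" using wR R(1) by (simp add: c_def)
  have k: "0 < k" using M(1) r(1) R(1) c by (simp add: k_def add_pos_pos)
  have L: "1 \<le> L" by (simp add: L_def)
  have "norm (grad x - grad y) \<le> (k * L) * \<omega> (norm (x - y))" if x: "\<beta> \<le> \<mu> x" and y: "\<beta> \<le> \<mu> y" for x y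
  proof -
    have nz: "x \<noteq> 0" "y \<noteq> 0" using x y \<beta> minkowski_zero by auto
    define s s' where "s = boundary_point x" and "s' = boundary_point y"
    have s: "s \<in> S" "s' \<in> S" using boundary_point_in nz by (auto simp: s_def s'_def)
    define d where "d = norm (s - s')"
    define a a' where "a = inner (N s) s" and "a' = inner (N s') s'"
    have a: "r \<le> a" "r \<le> a'" using support_ge s by (auto simp: a_def a'_def)
    then have ap: "0 < a" "0 < a'" using r(1) by auto
    have nN: "norm (N s - N s') \<le> M * \<omega> d" using M(2) s by (simp add: d_def)
    have "norm s \<le> R" "norm s' \<le> R" using R(2) S_subset s by auto
    then have "d \<le> 2 * R" using norm_triangle_ineq4[of s s'] by (simp add: d_def)
    then have "d * \<omega> (2 * R) \<le> 2 * R * \<omega> d" by (intro modulus_star) (auto simp: d_def)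
    then have dc: "d \<le> c * \<omega> d" using wR by (simp add: c_def field_simps)
    have "\<bar>a' - a\<bar> = \<bar>inner (N s' - N s) s' + inner (N s) (s' - s)\<bar>"
      by (simp add: a_def a'_def inner_diff_left inner_diff_right)
    also have "\<dots> \<le> norm (N s' - N s) * norm s' + norm (N s) * norm (s' - s)"
      by (intro order_trans[OF abs_triangle_ineq] add_mono Cauchy_Schwarz_ineq2)
    also have "\<dots> \<le> (M * \<omega> d) * R + 1 * (c * \<omega> d)"
      using nN \<open>norm s' \<le> R\<close> dc norm_N[OF s(1)] R(1)
      by (intro add_mono mult_mono) (auto simp: norm_minus_commute d_def intro: order_trans[OF norm_ge_zero])
    finally have aa: "\<bar>a' - a\<bar> \<le> (M * R + c) * \<omega> d" by (simp add: algebra_simps)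
    have "grad x - grad y = (1 / a) *\<^sub>R (N s - N s') + ((a' - a) / (a * a')) *\<^sub>R N s'"
      using ap by (simp add: grad_def s_def[symmetric] s'_def[symmetric] a_def[symmetric] a'_def[symmetric]
          algebra_simps diff_divide_distrib divide_inverse)
    then have "norm (grad x - grad y) \<le> norm ((1 / a) *\<^sub>R (N s - N s')) + norm (((a' - a) / (a * a')) *\<^sub>R N s')"
      by (metis norm_triangle_ineq)
    also have "\<dots> = norm (N s - N s') / a + \<bar>a' - a\<bar> / (a * a')" using ap norm_N[OF s(2)] by (simp add: abs_mult)
    also have "\<dots> \<le> (M * \<omega> d) / r + ((M * R + c) * \<omega> d) / (r * r)"
      using nN aa a r(1) ap order_trans[OF norm_ge_zero nN] order_trans[OF abs_ge_zero aa]
      by (intro add_mono frac_le mult_mono) auto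
    also have "\<dots> = k * \<omega> d" by (simp add: k_def algebra_simps add_divide_distrib power2_eq_square)
    also have "\<dots> \<le> k * (L * \<omega> (norm (x - y)))"
    proof (intro mult_left_mono)
      have "d \<le> (1 + R / r) / \<beta> * norm (x - y)"
        using boundary_point_lipschitz[OF \<beta> x y] by (simp add: d_def s_def s'_def)
      also have "\<dots> \<le> L * norm (x - y)" by (intro mult_right_mono) (auto simp: L_def)
      finally have "\<omega> d \<le> \<omega> (L * norm (x - y))" by (intro modulus_mono) (auto simp: d_def)
      also have "\<dots> \<le> L * \<omega> (norm (x - y))" using L by (intro modulus_scale) auto
      finally show "\<omega> d \<le> L * \<omega> (norm (x - y))" .
    qed (use k in auto)
    finally show ?thesis by simp
  qed
  then show ?thesis using k L by (intro exI[of _ "k * L"]) auto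
qed

lemma normal_modulus_imp_minkowski_smooth:
  assumes M: "0 < M" "\<And>x y. x \<in> S \<Longrightarrow> y \<in> S \<Longrightarrow> norm (N x - N y) \<le> M * \<omega> (norm (x - y))"
    and \<alpha>: "0 < \<alpha>"
  shows "\<exists>G. (\<forall>x. \<alpha> \<le> \<mu> x \<longrightarrow> (\<mu> has_derivative blinfun_apply (G x)) (at x)) \<and>
    (\<exists>K>0. \<forall>x y. \<alpha> \<le> \<mu> x \<longrightarrow> \<alpha> \<le> \<mu> y \<longrightarrow> norm (G x - G y) \<le> K * \<omega> (norm (x - y)))"
proof -
  \<comment> \<open>The level \<open>\<alpha> / 2\<close> leaves room to compare \<open>x\<close>
    with neighbours where \<open>\<mu>\<close> drops below \<open>\<alpha>\<close>.\<close>
  obtain K where K: "0 < K"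
    "\<And>x y. \<alpha> / 2 \<le> \<mu> x \<Longrightarrow> \<alpha> / 2 \<le> \<mu> y \<Longrightarrow> norm (grad x - grad y) \<le> K * \<omega> (norm (x - y))"
    using grad_modulus[OF M, of "\<alpha> / 2"] \<alpha> by auto
  define G where "G x = blinfun_inner_right (grad x)" for x
  have G: "blinfun_apply (G x) h = inner (grad x) h" for x h by (simp add: G_def)
  have "(\<mu> has_derivative blinfun_apply (G x)) (at x)" if x: "\<alpha> \<le> \<mu> x" for x
  proof -
    have nz: "x \<noteq> 0" using x \<alpha> minkowski_zero by auto
    \<comment> \<open>The first bound keeps \<open>x + u\<close> away from 0; the second keeps
      \<open>\<mu> (x + u) \<ge> \<alpha> / 2\<close>.\<close>
    define \<epsilon> where "\<epsilon> = min (norm x) (r * \<alpha> / 2)"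
    have \<epsilon>: "0 < \<epsilon>" using nz r(1) \<alpha> by (simp add: \<epsilon>_def)
    show ?thesis
    proof (rule has_derivative_of_modulus_bound[OF _ \<epsilon>, where K = K])
      show "bounded_linear (blinfun_apply (G x))" by (rule blinfun.bounded_linear_right)
      fix u :: 'a assume u: "norm u < \<epsilon>"
      have nz': "x + u \<noteq> 0" using u by (auto simp: \<epsilon>_def add_eq_0_iff)
      have "norm u / r \<le> \<alpha> / 2" using u r(1) by (simp add: \<epsilon>_def field_simps)
      moreover have "\<mu> x - \<mu> (x + u) \<le> norm u / r" using minkowski_lipschitz[OF nz nz'] by simp
      ultimately have near: "\<alpha> / 2 \<le> \<mu> (x + u)" using x by linarith
      have "inner (grad x) u \<le> \<mu> (x + u) - \<mu> x" using grad_subgradient[OF nz, of "x + u"] by simp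
      moreover have "\<mu> (x + u) - \<mu> x \<le> inner (grad (x + u)) u" using grad_subgradient[OF nz', of x] by simp
      \<comment> \<open>The subgradients at the two ends sandwich the increment, so the remainder is
        at most the gradient difference against \<open>u\<close>.\<close>
      ultimately have "\<bar>\<mu> (x + u) - \<mu> x - inner (grad x) u\<bar> \<le> inner (grad (x + u) - grad x) u"
        by (simp add: inner_diff_left)
      also have "\<dots> \<le> norm (grad (x + u) - grad x) * norm u" by (rule norm_cauchy_schwarz)
      also have "\<dots> \<le> K * \<omega> (norm u) * norm u"
        using K(2)[OF near, of x] x \<alpha> by (intro mult_right_mono) auto
      finally show "\<bar>\<mu> (x + u) - \<mu> x - blinfun_apply (G x) u\<bar> \<le> K * (norm u * \<omega> (norm u))"
        by (simp add: G mult.commute mult.left_commute)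
    qed
  qed
  moreover have "norm (G x - G y) \<le> K * \<omega> (norm (x - y))" if "\<alpha> \<le> \<mu> x" "\<alpha> \<le> \<mu> y" for x y
  proof -
    have "norm (G x - G y) \<le> norm (grad x - grad y)"
      by (rule norm_blinfun_bound)
        (auto simp: blinfun.diff_left G inner_diff_left[symmetric] intro: Cauchy_Schwarz_ineq2)
    then show ?thesis using K(2)[of x y] that \<alpha> by simp
  qed
  ultimately show ?thesis using K(1) by blast
qed

end

section \<open>Assembly: (1), (2), (3), (4), (5) in a cycle, and (1) with (6) for bounded
  bodies\<close>

theorem theorem3p2:
  fixes V :: "'a::{real_inner, complete_space} set"
    and N :: "'a \<Rightarrow> 'a"
    and \<omega> :: "real \<Rightarrow> real"
  assumes "convex_body V"
    and "C1_hypersurface (frontier V)"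
    and "outer_unit_normal V N"
    and "modulus_of_continuity \<omega>"
  defines "P1 \<equiv> (\<exists>M>0. \<forall>x\<in>frontier V. \<forall>y\<in>frontier V. norm (N x - N y) \<le> M * \<omega> (norm (x - y)))"
    and "P2 \<equiv> (\<exists>M>0. \<forall>x\<in>frontier V.
              {p. inner (N x) (x - p) \<ge> M * integral {0..2 * norm (x - p)} \<omega>} \<subseteq> V \<and>
              frontier V \<inter> {p. inner (N x) (x - p) \<ge> M * integral {0..2 * norm (x - p)} \<omega>} = {x})"
    and "P3 \<equiv> (\<exists>M>0. \<forall>x\<in>frontier V. \<forall>y\<in>frontier V.
              inner (N y) (y - x) \<ge>
                norm (N x - N y) / 2 * modinv \<omega> (norm (N x - N y) / (4 * M)))"
    and "P4 \<equiv> (\<exists>F F'. convex_on UNIV F \<and> C1w_with \<omega> F F' \<and> frontier V = F -` {1} \<and>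
              (\<forall>x\<in>frontier V. \<forall>h. blinfun_apply (F' x) h = inner (N x) h))"
    and "P5 \<equiv> convex_hypersurface_C1w \<omega> (frontier V)"
    and "P6 \<equiv> (\<forall>\<alpha>>0. \<exists>G. (\<forall>x\<in>{x. minkowski_functional V x \<ge> \<alpha>}.
                 (minkowski_functional V has_derivative blinfun_apply (G x)) (at x)) \<and>
              (\<exists>K>0. \<forall>x\<in>{x. minkowski_functional V x \<ge> \<alpha>}. \<forall>y\<in>{x. minkowski_functional V x \<ge> \<alpha>}.
                 norm (G x - G y) \<le> K * \<omega> (norm (x - y))))"
  shows "(P1 \<longleftrightarrow> P2) \<and> (P1 \<longleftrightarrow> P3) \<and> (P1 \<longleftrightarrow> P4) \<and> (P1 \<longleftrightarrow> P5) \<and>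
         (bounded V \<and> 0 \<in> interior V \<longrightarrow> (P1 \<longleftrightarrow> P6))"
proof -
  interpret smooth_convex_body \<omega> V N using assms(1-4) by unfold_locales
  have phi: "integral {0..2 * norm (x - p)} \<omega> = \<phi> (2 * norm (x - p))" for x p :: 'a
    by (simp add: \<phi>_def)
  have P12: P2 if P1
  proof -
    obtain M where M: "0 < M" "\<And>x y. x \<in> S \<Longrightarrow> y \<in> S \<Longrightarrow> norm (N x - N y) \<le> M * \<omega> (norm (x - y))"
      using \<open>P1\<close> unfolding P1_def by blast
    have "{p. inner (N x) (x - p) \<ge> 2 * M * \<phi> (2 * norm (x - p))} \<subseteq> V \<and>
        S \<inter> {p. inner (N x) (x - p) \<ge> 2 * M * \<phi> (2 * norm (x - p))} = {x}" if x: "x \<in> S" for x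
    proof -
      have int: "p \<in> interior V" if "2 * M * \<phi> (2 * norm (x - p)) \<le> inner (N x) (x - p)" "p \<noteq> x" for p
        using normal_modulus_imp_inner_region[OF M x that] .
      then have "p \<in> V" if "2 * M * \<phi> (2 * norm (x - p)) \<le> inner (N x) (x - p)" for p
        using that interior_subset S_subset[OF x] by (cases "p = x") auto
      moreover have "p = x" if "2 * M * \<phi> (2 * norm (x - p)) \<le> inner (N x) (x - p)" "p \<in> S" for p
        using int[OF that(1)] that(2) by (auto simp: frontier_def)
      ultimately show ?thesis using x by auto
    qed
    then show P2 unfolding P2_def phi using M(1) by (intro exI[of _ "2 * M"]) auto
  qed
  have P23: P3 if P2
  proof -
    obtain M where M: "0 < M"
      "\<And>x p. x \<in> S \<Longrightarrow> M * \<phi> (2 * norm (x - p)) \<le> inner (N x) (x - p) \<Longrightarrow> p \<in> V"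
      using \<open>P2\<close> unfolding P2_def phi by blast
    show P3 unfolding P3_def
      using inner_region_imp_monotone[OF M] M(1) by (intro exI[of _ "2 * M"]) auto
  qed
  have P3E: thesis if P3 and "\<And>M. 0 < M \<Longrightarrow> (\<And>x y. x \<in> S \<Longrightarrow> y \<in> S \<Longrightarrow>
      norm (N x - N y) / 2 * modinv \<omega> (norm (N x - N y) / (4 * M)) \<le> inner (N y) (y - x)) \<Longrightarrow> thesis" for thesis
    using that unfolding P3_def by blast
  have P31: P1 if P3
  proof (rule P3E[OF that])
    fix M :: real
    assume M: "0 < M" "\<And>x y. x \<in> S \<Longrightarrow> y \<in> S \<Longrightarrow>
      norm (N x - N y) / 2 * modinv \<omega> (norm (N x - N y) / (4 * M)) \<le> inner (N y) (y - x)"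
    show P1 unfolding P1_def
      using monotone_imp_normal_modulus[OF M] M(1) by (intro exI[of _ "4 * M"]) auto
  qed
  have P34: P4 if P3
    unfolding P4_def by (rule P3E[OF that]) (rule monotone_imp_convex_extension)
  have P45: P5 if P4
  proof -
    obtain F F' where F: "convex_on UNIV F" "C1w_with \<omega> F F'" "S = F -` {1}"
      and grad: "\<And>x h. x \<in> S \<Longrightarrow> blinfun_apply (F' x) h = inner (N x) h"
      using \<open>P4\<close> unfolding P4_def by blast
    \<comment> \<open>The gradient is a unit normal on \<open>S\<close>, so the two-sided bound of
      (5) holds with constant 1.\<close>
    have "norm (F' x) = 1" if x: "x \<in> S" for x
    proof (rule antisym)
      show "1 \<le> norm (F' x)" using norm_riesz_le[of "F' x" "N x"] grad[OF x] norm_N[OF x] by simp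
      show "norm (F' x) \<le> 1"
      proof (rule norm_blinfun_bound)
        fix h show "norm (blinfun_apply (F' x) h) \<le> 1 * norm h"
          using Cauchy_Schwarz_ineq2[of "N x" h] norm_N[OF x] grad[OF x] by simp
      qed simp
    qed
    then show P5 unfolding P5_def convex_hypersurface_C1w_def
      using F by (intro exI[of _ 1] conjI exI[of _ F] exI[of _ F']) auto
  qed
  have P51: P1 if P5
    unfolding P1_def using convex_hypersurface_imp_normal_modulus that by (simp add: P5_def)
  have P16: "P1 \<longleftrightarrow> P6" if bd: "bounded V \<and> 0 \<in> interior V"
  proof -
    obtain r where r: "0 < r" "ball 0 r \<subseteq> V" using bd by (auto simp: mem_interior)
    obtain R where R: "0 < R" "\<And>x. x \<in> V \<Longrightarrow> norm x \<le> R" using bd bounded_pos by blast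
    interpret bounded_smooth_convex_body \<omega> V N r R using r R by unfold_locales
    show ?thesis
    proof
      assume P1
      then obtain M where M: "0 < M"
        "\<And>x y. x \<in> S \<Longrightarrow> y \<in> S \<Longrightarrow> norm (N x - N y) \<le> M * \<omega> (norm (x - y))"
        unfolding P1_def by blast
      show P6 unfolding P6_def
        using normal_modulus_imp_minkowski_smooth[OF M] by simp
    next
      assume P6
      \<comment> \<open>The single level 1 suffices, since \<open>\<mu> = 1\<close> on
        \<open>S\<close>.\<close>
      then have "\<exists>G. (\<forall>x\<in>{x. 1 \<le> \<mu> x}. (\<mu> has_derivative blinfun_apply (G x)) (at x)) \<and>
          (\<exists>K>0. \<forall>x\<in>{x. 1 \<le> \<mu> x}. \<forall>y\<in>{x. 1 \<le> \<mu> x}. norm (G x - G y) \<le> K * \<omega> (norm (x - y)))"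
        unfolding P6_def by (rule allE[of _ 1]) simp
      then obtain G K where G: "\<And>x. 1 \<le> \<mu> x \<Longrightarrow> (\<mu> has_derivative blinfun_apply (G x)) (at x)"
        and K: "0 < K" "\<And>x y. 1 \<le> \<mu> x \<Longrightarrow> 1 \<le> \<mu> y \<Longrightarrow> norm (G x - G y) \<le> K * \<omega> (norm (x - y))"
        by blast
      show P1 unfolding P1_def
        using minkowski_smooth_imp_normal_modulus[OF G K] R(1) K(1)
        by (intro exI[of _ "2 * R * K"]) auto
    qed
  qed
  show ?thesis using P12 P23 P31 P34 P45 P51 P16 by blast
qed

end
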